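(* Let $n\ge1$. The maps $$\mathbf f:(\mathcal Fl^a_{n+1})^{T_n}\to\mathrm{DC}_{n+1},\quad \mathbf b:\mathrm{DC}_{n+1}\to W^J_{\le\tau_{n+1}},\quad \alpha:W^J_{\le\tau_{n+1}}\to X_{\sigma_n}^{T_{2n-1}},\quad \beta:(\mathcal Fl^a_{n+1})^{T_n}\to X_{\sigma_n}^{T_{2n-1}}$$ form a commutative diagram, i.e. $\beta=\alpha\circ\mathbf b\circ\mathbf f$.
   Context: **Degenerate flag variety.** Fix a basis $f_1,\dots,f_{n+1}$ of $\mathbb C^{n+1}$ and let $\mathrm{pr}_i$ be the projection along $f_i$ (setting the $i$-th coordinate to $0$). $\mathcal Fl^a_{n+1}=\{(V_1,\dots,V_n)\in\prod_{i=1}^n\mathrm{Gr}_i(\mathbb C^{n+1}) : \mathrm{pr}_{i+1}(V_i)\subset V_{i+1}\text{ for } 1\le i\le n-1\}$. $T_n$ is the diagonal torus of $SL_{n+1}$. Its fixed points are identified with tuples $\mathbf I=(I_1,\dots,I_n)$ of subsets of $\{1,\dots,n+1\}$ with $\#I_k=k$ and $I_k\setminus\{k+1\}\subset I_{k+1}$ for $1\le k\le n-1$, via $V_k=\langle f_i: i\in I_k\rangle$. Put $I_0=\emptyset$ and $I_{n+1}=\{1,\dots,n+1\}$. **Dellac configurations.** $\mathrm{DC}_{n+1}$ is the set of boards with $2n+2$ columns and $n+1$ rows with $2n+2$ marked cells such that each column contains exactly one marked cell, each row exactly two, and if $(i,j)$ (row $i$, column $j$) is marked then $i\le j\le n+1+i$.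 **The map $\mathbf f$** (Feigin's bijection). The marked cells of $\mathbf f(\mathbf I)$ in row $l$, $1\le l\le n+1$, are as follows, where for $j\in\{1,\dots,n+1\}$ we put $c_l(j)=j$ if $j>l$ and $c_l(j)=j+n+1$ if $j\le l$: - if $l\notin I_{l-1}$, then $I_l\setminus I_{l-1}=\{j\}$, and $(l,l)$ and $(l,c_l(j))$ are marked; - if $l\in I_{l-1}$ and $l\in I_l$, then $I_l\setminus I_{l-1}=\{j\}$, and $(l,l+n+1)$ and $(l,c_l(j))$ are marked; - if $l\in I_{l-1}$ and $l\notin I_l$, then $I_l\setminus I_{l-1}=\{j_1,j_2\}$, and $(l,c_l(j_1))$ and $(l,c_l(j_2))$ are marked. **The map $\mathbf b$.** $W=\mathfrak S_{2n+2}$ with $s_i=(i,i+1)$, $J=\{s_1,s_3,\dots,s_{2n+1}\}$, $W_J=\langle J\rangle$, $W^J$ is the set of minimal length representatives of the cosets $wW_J$, i.e. $W^J=\{\sigma:\sigma(2k-1)<\sigma(2k),\ 1\le k\le n+1\}$. $\tau_{n+1}\in W^J$ is given by $\tau_{n+1}(2k-1)=k$, $\tau_{n+1}(2k)=n+1+k$ for $1\le k\le n+1$, and $W^J_{\le\tau_{n+1}}=\{w\in W^J: w\le\tau_{n+1}\}$ for the Bruhat order. For $C\in\mathrm{DC}_{n+1}$, $\mathbf b(C)=\sigma$ is the permutation such that, for each $k$, $\sigma(2k-1)<\sigma(2k)$ are the two columns of the marked cells in row $k$ of $C$. **Schubert variety and $\alpha$.** $\sigma_n\in\mathfrak S_{2n}$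 is given by $\sigma_n(2k)=k$ for $1\le k\le n$ and $\sigma_n(2k+1)=n+1+k$ for $0\le k\le n-1$. $X_{\sigma_n}$ is the corresponding Schubert variety in the variety $SL_{2n}/P$ of partial flags in $\mathbb C^{2n}$ (with basis $e_1,\dots,e_{2n}$) of dimensions $1,3,\dots,2n-1$; $T_{2n-1}$ is the diagonal torus of $SL_{2n}$. A point of $X_{\sigma_n}^{T_{2n-1}}$ is a flag of coordinate subspaces and is identified with a tuple $(J_1,\dots,J_n)$ of subsets of $\{1,\dots,2n\}$, $\#J_i=2i-1$, where the $(2i-1)$-dimensional member is $\langle e_j:j\in J_i\rangle$. Every $\sigma\in W^J_{\le\tau_{n+1}}$ satisfies $\sigma(1)=1$, $\sigma(2n+2)=2n+2$; define $\overline\sigma\in\mathfrak S_{2n}$ by $\overline\sigma(i)=\sigma(i+1)-1$. Then $\alpha(\sigma)=(J_1,\dots,J_n)$ with $J_i=\{\overline\sigma(1),\dots,\overline\sigma(2i-1)\}$. **The map $\beta$** (the restriction to fixed points of the Cerulli Irelli–Lanini isomorphism $\zeta:\mathcal Fl^a_{n+1}\to X_{\sigma_n}$, with a twist accounting for different conventions). Let $\kappa\in\mathfrak S_{n+1}$ be the inverse of the cycle $(1\,2\,\cdots\,n+1)$, i.e. $\kappa(i)=i-1$ for $i\ge2$ and $\kappa(1)=n+1$; put $I_l^\kappa=\kappa(I_l)$. For $1\le l\le n$ define $p_l:\{1,\dots,n+l\}\to\{0,1,\dots,n+1\}$ by $p_l(s)=0$ if $1\le s\le l-1$; $p_l(s)=s$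 if $l\le s\le n+1$; $p_l(s)=s-n-1$ if $n+2\le s\le n+l$. Then $\beta(\mathbf I)=(T_1,\dots,T_n)$ with $T_l=p_l^{-1}(I_l^\kappa\cup\{0\})$, i.e. the coordinate subspaces $\pi_l^{-1}(\langle f_i:i\in I_l^\kappa\rangle)$, where $\pi_l:\langle e_1,\dots,e_{n+l}\rangle\to\mathbb C^{n+1}$ is linear with $\pi_l(e_s)=f_{p_l(s)}$ and $f_0:=0$. *)

theory Defs
  imports
    "HOL-Algebra.Sym_Groups"
    "HOL-Combinatorics.Transposition"
    "Jordan_Normal_Form.VS_Connect"
    "Jordan_Normal_Form.Determinant"
begin

text \<open>
  Families indexed by \<open>1, \<dots>, n\<close> are extensional functions on \<open>{1..n}\<close>. The library numbers
  coordinates of vectors from 0, while basis vectors are numbered from 1 here.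
\<close>

definition basis_vec :: "nat \<Rightarrow> nat \<Rightarrow> complex vec" where
  "basis_vec m i = unit_vec m (i - 1)"

abbreviation cspace :: "nat \<Rightarrow> (complex, complex vec) module" where
  "cspace m \<equiv> module_vec TYPE(complex) m"

definition Gr :: "nat \<Rightarrow> nat \<Rightarrow> complex vec set set" where
  "Gr k m = {U. subspace class_ring U (cspace m) \<and>
                vectorspace.dim class_ring ((cspace m)\<lparr>carrier := U\<rparr>) = k}"

definition coord_subspaces :: "nat \<Rightarrow> nat \<Rightarrow> (nat \<Rightarrow> nat set) \<Rightarrow> nat \<Rightarrow> complex vec set" where
  "coord_subspaces m n I =
     (\<lambda>k\<in>{1..n}. LinearCombinations.module.span class_ring (cspace m) (basis_vec m ` I k))"

text \<open>On families of coordinate subspaces this is inverse to \<open>coord_subspaces\<close>.\<close>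

definition index_sets :: "nat \<Rightarrow> nat \<Rightarrow> (nat \<Rightarrow> complex vec set) \<Rightarrow> nat \<Rightarrow> nat set" where
  "index_sets m n V = (\<lambda>k\<in>{1..n}. {i \<in> {1..m}. basis_vec m i \<in> V k})"

definition SL :: "nat \<Rightarrow> complex mat set" where
  "SL m = {A \<in> carrier_mat m m. det A = 1}"

definition diag_torus :: "nat \<Rightarrow> complex mat set" where
  "diag_torus m = {A \<in> SL m. diagonal_mat A}"

definition borel :: "nat \<Rightarrow> complex mat set" where
  "borel m = {A \<in> SL m. upper_triangular A}"

definition act :: "nat \<Rightarrow> complex mat \<Rightarrow> (nat \<Rightarrow> complex vec set) \<Rightarrow> nat \<Rightarrow> complex vec set" where
  "act n A V = (\<lambda>k\<in>{1..n}. (\<lambda>v. A *\<^sub>v v) ` V k)"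

definition torus_fixed ::
  "nat \<Rightarrow> nat \<Rightarrow> (nat \<Rightarrow> complex vec set) set \<Rightarrow> (nat \<Rightarrow> complex vec set) set" where
  "torus_fixed m n X = {V \<in> X. \<forall>t \<in> diag_torus m. act n t V = V}"

definition pr :: "nat \<Rightarrow> nat \<Rightarrow> complex vec \<Rightarrow> complex vec" where
  "pr m i v = vec m (\<lambda>j. if j = i - 1 then 0 else v $ j)"

definition degenerate_flags :: "nat \<Rightarrow> (nat \<Rightarrow> complex vec set) set" where
  "degenerate_flags n =
     {V \<in> (\<Pi>\<^sub>E i\<in>{1..n}. Gr i (n + 1)). \<forall>i\<in>{1..<n}. pr (n + 1) (i + 1) ` V i \<subseteq> V (i + 1)}"

definition odd_flags :: "nat \<Rightarrow> (nat \<Rightarrow> complex vec set) set" where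
  "odd_flags n =
     {V \<in> (\<Pi>\<^sub>E i\<in>{1..n}. Gr (2 * i - 1) (2 * n)). \<forall>i\<in>{1..<n}. V i \<subseteq> V (i + 1)}"

definition perm_flag :: "nat \<Rightarrow> (nat \<Rightarrow> nat) \<Rightarrow> nat \<Rightarrow> complex vec set" where
  "perm_flag n \<sigma> = coord_subspaces (2 * n) n (\<lambda>i. \<sigma> ` {1..2 * i - 1})"

inductive_set mat_polynomials :: "nat \<Rightarrow> (complex mat \<Rightarrow> complex) set" for m where
  const: "(\<lambda>A. c) \<in> mat_polynomials m"
| entry: "i < m \<Longrightarrow> j < m \<Longrightarrow> (\<lambda>A. A $$ (i, j)) \<in> mat_polynomials m"
| add: "p \<in> mat_polynomials m \<Longrightarrow> q \<in> mat_polynomials m \<Longrightarrow> (\<lambda>A. p A + q A) \<in> mat_polynomials m"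
| mult: "p \<in> mat_polynomials m \<Longrightarrow> q \<in> mat_polynomials m \<Longrightarrow> (\<lambda>A. p A * q A) \<in> mat_polynomials m"

definition zariski_closed_SL :: "nat \<Rightarrow> complex mat set \<Rightarrow> bool" where
  "zariski_closed_SL m Z \<longleftrightarrow>
     (\<exists>S \<subseteq> mat_polynomials m. Z = {A \<in> SL m. \<forall>p\<in>S. p A = 0})"

text \<open>
  The group \<open>SL (2 * n)\<close> acts transitively on the partial flags, and the stabilizer of
  \<open>perm_flag n id\<close> is the standard parabolic \<open>P\<close>. The Zariski topology on \<open>SL / P\<close> is the
  quotient topology.
\<close>

definition zariski_closed_flags :: "nat \<Rightarrow> (nat \<Rightarrow> complex vec set) set \<Rightarrow> bool" where
  "zariski_closed_flags n Y \<longleftrightarrow> Y \<subseteq> odd_flags n \<and>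
     zariski_closed_SL (2 * n) {A \<in> SL (2 * n). act n A (perm_flag n id) \<in> Y}"

definition schubert_variety :: "nat \<Rightarrow> (nat \<Rightarrow> nat) \<Rightarrow> (nat \<Rightarrow> complex vec set) set" where
  "schubert_variety n \<sigma> =
     \<Inter> {Y. zariski_closed_flags n Y \<and> (\<lambda>A. act n A (perm_flag n \<sigma>)) ` borel (2 * n) \<subseteq> Y}"

definition sigma_perm :: "nat \<Rightarrow> nat \<Rightarrow> nat" where
  "sigma_perm n i =
     (if i \<in> {1..2 * n} then (if even i then i div 2 else n + 1 + i div 2) else i)"

text \<open>Boards with \<open>N\<close> rows and \<open>2 * N\<close> columns, given by their sets of marked (row, column) pairs.\<close>

definition dellac :: "nat \<Rightarrow> (nat \<times> nat) set set" where
  "dellac N = {C. C \<subseteq> {1..N} \<times> {1..2 * N} \<and> card C = 2 * N \<and>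
     (\<forall>j\<in>{1..2 * N}. card {i. (i, j) \<in> C} = 1) \<and>
     (\<forall>i\<in>{1..N}. card {j. (i, j) \<in> C} = 2) \<and>
     (\<forall>(i, j)\<in>C. i \<le> j \<and> j \<le> N + i)}"

text \<open>Permutations of \<open>{1..m}\<close> are functions that are the identity outside \<open>{1..m}\<close>.\<close>

definition cox_length :: "nat \<Rightarrow> (nat \<Rightarrow> nat) \<Rightarrow> nat" where
  "cox_length m w = (LEAST k. \<exists>is. length is = k \<and> set is \<subseteq> {1..<m} \<and>
     w = foldr (\<circ>) (map (\<lambda>i. transpose i (i + 1)) is) id)"

definition bruhat_step :: "nat \<Rightarrow> (nat \<Rightarrow> nat) \<Rightarrow> (nat \<Rightarrow> nat) \<Rightarrow> bool" where
  "bruhat_step m u w \<longleftrightarrow> u permutes {1..m} \<and>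
     (\<exists>a\<in>{1..m}. \<exists>b\<in>{1..m}. a \<noteq> b \<and> w = u \<circ> transpose a b) \<and> cox_length m u < cox_length m w"

definition bruhat_le :: "nat \<Rightarrow> (nat \<Rightarrow> nat) \<Rightarrow> (nat \<Rightarrow> nat) \<Rightarrow> bool" where
  "bruhat_le m = (bruhat_step m)\<^sup>*\<^sup>*"

definition W_J :: "nat \<Rightarrow> (nat \<Rightarrow> nat) set" where
  "W_J N = generate (sym_group (2 * N)) ((\<lambda>k. transpose (2 * k - 1) (2 * k)) ` {1..N})"

definition min_reps :: "nat \<Rightarrow> (nat \<Rightarrow> nat) set" where
  "min_reps N = {w \<in> carrier (sym_group (2 * N)).
     \<forall>v \<in> w <#\<^bsub>sym_group (2 * N)\<^esub> W_J N. cox_length (2 * N) w \<le> cox_length (2 * N) v}"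

definition tau_perm :: "nat \<Rightarrow> nat \<Rightarrow> nat" where
  "tau_perm N i =
     (if i \<in> {1..2 * N} then (if odd i then (i + 1) div 2 else N + i div 2) else i)"

definition min_reps_le_tau :: "nat \<Rightarrow> (nat \<Rightarrow> nat) set" where
  "min_reps_le_tau N = {w \<in> min_reps N. bruhat_le (2 * N) w (tau_perm N)}"

definition col :: "nat \<Rightarrow> nat \<Rightarrow> nat \<Rightarrow> nat" where
  "col n l j = (if j > l then j else j + n + 1)"

definition extend_ends :: "nat \<Rightarrow> (nat \<Rightarrow> nat set) \<Rightarrow> nat \<Rightarrow> nat set" where
  "extend_ends n I k = (if k = 0 then {} else if k = n + 1 then {1..n + 1} else I k)"

text \<open>
  For the index sets of a fixed point, \<open>B - A\<close> has one element in the first two cases and two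
  elements in the third.
\<close>

definition row_cols :: "nat \<Rightarrow> (nat \<Rightarrow> nat set) \<Rightarrow> nat \<Rightarrow> nat set" where
  "row_cols n I l =
     (let A = extend_ends n I (l - 1); B = extend_ends n I l in
      if l \<notin> A then {l} \<union> col n l ` (B - A)
      else if l \<in> B then {l + n + 1} \<union> col n l ` (B - A)
      else col n l ` (B - A))"

definition f_map :: "nat \<Rightarrow> (nat \<Rightarrow> complex vec set) \<Rightarrow> (nat \<times> nat) set" where
  "f_map n V = (SIGMA l:{1..n + 1}. row_cols n (index_sets (n + 1) n V) l)"

definition b_map :: "nat \<Rightarrow> (nat \<times> nat) set \<Rightarrow> nat \<Rightarrow> nat" where
  "b_map n C i =
     (if i \<in> {1..2 * n + 2}
      then (if odd i then Min {j. ((i + 1) div 2, j) \<in> C} else Max {j. (i div 2, j) \<in> C})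
      else i)"

definition bar :: "nat \<Rightarrow> (nat \<Rightarrow> nat) \<Rightarrow> nat \<Rightarrow> nat" where
  "bar n \<sigma> i = (if i \<in> {1..2 * n} then \<sigma> (i + 1) - 1 else i)"

definition alpha :: "nat \<Rightarrow> (nat \<Rightarrow> nat) \<Rightarrow> nat \<Rightarrow> complex vec set" where
  "alpha n \<sigma> = perm_flag n (bar n \<sigma>)"

definition kappa :: "nat \<Rightarrow> nat \<Rightarrow> nat" where
  "kappa n i = (if i = 1 then n + 1 else i - 1)"

definition p_map :: "nat \<Rightarrow> nat \<Rightarrow> nat \<Rightarrow> nat" where
  "p_map n l s = (if s < l then 0 else if s \<le> n + 1 then s else s - n - 1)"

definition beta_sets :: "nat \<Rightarrow> (nat \<Rightarrow> nat set) \<Rightarrow> nat \<Rightarrow> nat set" where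
  "beta_sets n I l = {s \<in> {1..n + l}. p_map n l s \<in> kappa n ` I l \<union> {0}}"

definition beta :: "nat \<Rightarrow> (nat \<Rightarrow> complex vec set) \<Rightarrow> nat \<Rightarrow> complex vec set" where
  "beta n V = coord_subspaces (2 * n) n (beta_sets n (index_sets (n + 1) n V))"

end

theory Submission
  imports Defs
begin

text \<open>
  Coxeter length counts inversions, so a permutation goes down in the Bruhat order exactly when
  an inverted pair of values is exchanged. A Dellac configuration other than the maximal one
  always admits an exchange that goes up and stays within Dellac configurations; hence \<open>b_map\<close>
  takes values below \<open>tau_perm\<close>. Going down in the Bruhat order corresponds to passing to the
  limit along a curve inside a Borel orbit, so the whole interval below \<open>tau_perm\<close> is mapped
  by \<open>alpha\<close> into the Schubert variety. Subspaces fixed by the torus are coordinate subspaces,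
  and the marked columns in the first \<open>l\<close> rows of \<open>f_map n V\<close> are \<open>1, \<dots>, l\<close> together with the
  images of the elements of \<open>I\<^sub>l\<close> under \<open>col n l\<close>; this set is \<open>beta_sets n I l\<close> shifted by one,
  apart from the column 1, which gives commutativity.
\<close>

section \<open>Length and Bruhat order\<close>

text \<open>\<open>schubert_variety\<close> is the intersection of all closed sets containing a
  Borel orbit, and closedness of a set of flags refers to its preimage in \<open>SL (2 * n)\<close>.
  So limits are not taken among flags: every curve is lifted to matrices of determinant 1 whose
  entries are polynomial in a parameter, also at the limit point. This is why permutations are
  represented by monomial matrices with adjustable coefficients, and why two columns are exchanged
  only up to sign. A Bruhat chain below \<open>tau_perm\<close> may leave the minimal
  representatives, so the descent runs through arbitrary permutations. It carries along that the
  first and the last value are fixed, which \<open>bar\<close> needs in order to give a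
  permutation.\<close>

definition inversions :: "nat \<Rightarrow> (nat \<Rightarrow> nat) \<Rightarrow> (nat \<times> nat) set" where
  "inversions m w = {(p, q). p \<in> {1..m} \<and> q \<in> {1..m} \<and> p < q \<and> w q < w p}"

lemma finite_inversions [simp]: "finite (inversions m w)"
  by (rule finite_subset[of _ "{1..m} \<times> {1..m}"]) (auto simp: inversions_def)

lemma card_inversions_le: "card (inversions m w) \<le> m * m"
proof -
  have "card (inversions m w) \<le> card ({1..m} \<times> {1..m})"
    by (rule card_mono) (auto simp: inversions_def)
  then show ?thesis by (simp add: card_cartesian_product)
qed

section \<open>Coxeter length as a count of inversions\<close>

lemma simple_transposition_less_iff:
  fixes x y :: nat
  assumes "\<not> (x = i \<and> y = Suc i)" "\<not> (x = Suc i \<and> y = i)"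
  shows "transpose i (Suc i) x < transpose i (Suc i) y \<longleftrightarrow> x < y"
  using assms by (auto simp: transpose_def)

text \<open>No value lies strictly between \<open>i\<close> and \<open>Suc i\<close>, so exchanging
  these two values changes the relative order only at the two positions that carry them.\<close>

lemma inversions_simple_comp:
  assumes w: "w permutes {1..m}" and i: "i \<in> {1..<m}"
    and asc: "inv' w i < inv' w (Suc i)"
  shows "inversions m (transpose i (Suc i) \<circ> w) =
           insert (inv' w i, inv' w (Suc i)) (inversions m w)"
    and "(inv' w i, inv' w (Suc i)) \<notin> inversions m w"
proof -
  define p q where "p = inv' w i" and "q = inv' w (Suc i)"
  have wp: "w p = i" and wq: "w q = Suc i"
    using permutes_inverses(1)[OF w] by (simp_all add: p_def q_def)
  have pq: "p < q" using asc by (simp add: p_def q_def)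
  have in_range: "p \<in> {1..m}" "q \<in> {1..m}"
    using permutes_in_image[OF w, of p] permutes_in_image[OF w, of q] wp wq i by auto
  have inj: "w x = w y \<longleftrightarrow> x = y" for x y
    using permutes_inj[OF w] by (simp add: inj_eq)
  have eq: "w x = i \<longleftrightarrow> x = p" "w x = Suc i \<longleftrightarrow> x = q" for x
    using inj[of x p] inj[of x q] wp wq by auto
  have "(x, y) \<in> inversions m (transpose i (Suc i) \<circ> w) \<longleftrightarrow>
      (x, y) \<in> insert (p, q) (inversions m w)" for x y
  proof (cases "(x = p \<and> y = q) \<or> (x = q \<and> y = p)")
    case True
    then show ?thesis using pq in_range wp wq by (auto simp: inversions_def)
  next
    case False
    then have "transpose i (Suc i) (w y) < transpose i (Suc i) (w x) \<longleftrightarrow> w y < w x"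
      by (intro simple_transposition_less_iff) (auto simp: eq)
    with False show ?thesis by (auto simp: inversions_def)
  qed
  then show "inversions m (transpose i (Suc i) \<circ> w) =
           insert (inv' w i, inv' w (Suc i)) (inversions m w)"
    by (auto simp: p_def q_def)
  show "(inv' w i, inv' w (Suc i)) \<notin> inversions m w"
    using wp wq by (auto simp: inversions_def p_def[symmetric] q_def[symmetric])
qed

lemma simple_transposition_permutes:
  "i \<in> {1..<m} \<Longrightarrow> transpose i (Suc i) permutes {1..m}"
  by (rule permutes_swap_id) auto

lemma card_inversions_simple_comp_le:
  assumes w: "w permutes {1..m}" and i: "i \<in> {1..<m}"
  shows "card (inversions m (transpose i (Suc i) \<circ> w)) \<le> Suc (card (inversions m w))"
proof (cases "inv' w i < inv' w (Suc i)")
  case True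
  then show ?thesis
    using inversions_simple_comp[OF w i] by simp
next
  case False
  \<comment> \<open>Here \<open>?v\<close> has the two values in increasing order, so the previous
    lemma applies to it. A second exchange gives back \<open>w\<close>, hence passing from
    \<open>w\<close> to \<open>?v\<close> only loses inversions.\<close>
  let ?v = "transpose i (Suc i) \<circ> w"
  have v: "?v permutes {1..m}"
    by (rule permutes_compose[OF w simple_transposition_permutes[OF i]])
  have iv: "inv' ?v = inv' w \<circ> transpose i (Suc i)"
    by (simp add: o_inv_distrib permutes_bij[OF w])
  have "inv' w i \<noteq> inv' w (Suc i)"
    using permutes_inj[OF permutes_inv[OF w]] by (simp add: inj_eq)
  with False have "inv' ?v i < inv' ?v (Suc i)"
    by (simp add: iv)
  from inversions_simple_comp(1)[OF v i this]
  have "inversions m ?v \<subseteq> inversions m w"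
    by (auto simp: o_assoc)
  then show ?thesis by (simp add: card_mono le_SucI)
qed

lemma word_permutes:
  fixes m :: nat
  shows "set is \<subseteq> {1..<m} \<Longrightarrow> foldr (\<circ>) (map (\<lambda>i. transpose i (i + 1)) is) id permutes {1..m}"
proof (induction "is")
  case Nil
  show ?case using permutes_id by (simp add: id_def)
next
  case (Cons i "is")
  then show ?case
    using permutes_compose[OF Cons.IH simple_transposition_permutes[of i m]] by (simp add: comp_def)
qed

lemma card_inversions_word:
  fixes m :: nat
  shows "set is \<subseteq> {1..<m} \<Longrightarrow>
     card (inversions m (foldr (\<circ>) (map (\<lambda>i. transpose i (i + 1)) is) id)) \<le> length is"
proof (induction "is")
  case Nil
  have "inversions m id = {}" by (auto simp: inversions_def)
  then show ?case by (simp add: id_def)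
next
  case (Cons i "is")
  let ?w = "\<lambda>is. foldr (\<circ>) (map (\<lambda>i. transpose i (i + 1)) is) id"
  have i: "i \<in> {1..<m}" and sub: "set is \<subseteq> {1..<m}" using Cons.prems by auto
  have "?w (i # is) = transpose i (Suc i) \<circ> ?w is" by simp
  then have "card (inversions m (?w (i # is))) \<le> Suc (card (inversions m (?w is)))"
    using card_inversions_simple_comp_le[OF word_permutes[OF sub] i] by (simp only:)
  also have "\<dots> \<le> length (i # is)" using Cons.IH[OF sub] by (simp only: list.size add_Suc_right add_0_right Suc_le_mono)
  finally show ?case .
qed

text \<open>Exchanging consecutive values that stand in the wrong order removes one inversion and
  splits off one letter on the left of the word. If there are none, the inverse permutation is
  increasing, hence the identity.\<close>

lemma reduced_word_exists:
  assumes "w permutes {1..m}"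
  shows "\<exists>is. length is = card (inversions m w) \<and> set is \<subseteq> {1..<m} \<and>
     w = foldr (\<circ>) (map (\<lambda>i. transpose i (i + 1)) is) id"
  using assms
proof (induction "card (inversions m w)" arbitrary: w rule: less_induct)
  case less
  note w = less.prems
  show ?case
  proof (cases "\<exists>i\<in>{1..<m}. inv' w (Suc i) < inv' w i")
    case True
    then obtain i where i: "i \<in> {1..<m}" and desc: "inv' w (Suc i) < inv' w i" by blast
    let ?v = "transpose i (Suc i) \<circ> w"
    have v: "?v permutes {1..m}"
      by (rule permutes_compose[OF w simple_transposition_permutes[OF i]])
    have iv: "inv' ?v = inv' w \<circ> transpose i (Suc i)"
      by (simp add: o_inv_distrib permutes_bij[OF w])
    have vv: "transpose i (Suc i) \<circ> ?v = w"
      by (simp add: o_assoc)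
    have asc: "inv' ?v i < inv' ?v (Suc i)"
      using desc by (simp add: iv)
    have card: "card (inversions m w) = Suc (card (inversions m ?v))"
      using inversions_simple_comp[OF v i asc] unfolding vv by simp
    obtain "is" where "length is = card (inversions m ?v)" "set is \<subseteq> {1..<m}"
      "?v = foldr (\<circ>) (map (\<lambda>i. transpose i (i + 1)) is) id"
      using less.hyps[OF _ v] card by auto
    then show ?thesis
      using vv i card by (intro exI[of _ "i # is"]) auto
  next
    case False
    let ?u = "inv' w"
    have u: "?u permutes {1..m}" by (rule permutes_inv[OF w])
    have asc: "?u i < ?u (Suc i)" if "i \<in> {1..<m}" for i
      using False that inj_eq[OF permutes_inj[OF u], of i "Suc i"] by (meson linorder_neqE_nat n_not_Suc_n)
    have ge: "i \<le> ?u i" if "i \<in> {1..m}" for i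
      using that
    proof (induction i)
      case (Suc i)
      show ?case
      proof (cases "i = 0")
        case True
        then show ?thesis using permutes_in_image[OF u, of 1] Suc.prems by auto
      next
        case False
        then show ?thesis using Suc asc[of i] by fastforce
      qed
    qed simp
    then have "?u = id" by (intro permutes_natset_ge[OF u]) auto
    then have "w = id" by (metis inv_id inv_inv_eq permutes_bij[OF w])
    moreover have "inversions m id = {}" by (auto simp: inversions_def)
    ultimately show ?thesis by (intro exI[of _ "[]"]) auto
  qed
qed

lemma cox_length_eq_inversions:
  assumes "w permutes {1..m}"
  shows "cox_length m w = card (inversions m w)"
  unfolding cox_length_def
  by (rule Least_equality) (use reduced_word_exists[OF assms] card_inversions_word in auto)

text \<open>An inversion is carried along by the exchange as long as its positions remain in order,
  and is kept in place otherwise. In the latter case one of its positions is \<open>a\<close> or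
  \<open>b\<close> and the other lies strictly between them, and \<open>w a < w b\<close> keeps it
  an inversion. The pair \<open>(a, b)\<close> is not hit, hence the strict inequality.\<close>

lemma card_inversions_transpose:
  assumes a: "a \<in> {1..m}" and b: "b \<in> {1..m}" and ab: "a < b" and w: "w a < w b"
  shows "card (inversions m w) < card (inversions m (w \<circ> transpose a b))"
proof -
  define t where "t = transpose a b"
  define \<phi> where "\<phi> = (\<lambda>(p, q). if t p < t q then (t p, t q) else (p, q))"
  have tt: "t (t x) = x" for x by (simp add: t_def)
  have range: "t x \<in> {1..m} \<longleftrightarrow> x \<in> {1..m}" for x
    using a b by (auto simp: t_def transpose_def)
  have inj: "inj_on \<phi> (inversions m w)"
    unfolding inj_on_def \<phi>_def using tt
    by (auto simp: inversions_def split: if_splits) (metis tt)+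
  have sub: "\<phi> ` inversions m w \<subseteq> inversions m (w \<circ> t)"
  proof
    fix z assume "z \<in> \<phi> ` inversions m w"
    then obtain p q where z: "z = \<phi> (p, q)" and pq: "(p, q) \<in> inversions m w" by auto
    show "z \<in> inversions m (w \<circ> t)"
    proof (cases "t p < t q")
      case True
      then show ?thesis using pq z range[of p] range[of q]
        by (simp add: \<phi>_def inversions_def tt)
    next
      case False
      then show ?thesis using pq z ab w
        by (auto simp: \<phi>_def inversions_def t_def transpose_def split: if_splits)
    qed
  qed
  have "(a, b) \<in> inversions m (w \<circ> t)"
    using a b ab w by (simp add: inversions_def t_def)
  moreover have "(a, b) \<notin> \<phi> ` inversions m w"
    using ab w by (auto simp: \<phi>_def inversions_def t_def transpose_def split: if_splits)
  ultimately have "\<phi> ` inversions m w \<subset> inversions m (w \<circ> t)" using sub by auto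
  then have "card (\<phi> ` inversions m w) < card (inversions m (w \<circ> t))"
    by (rule psubset_card_mono[OF finite_inversions])
  then show ?thesis by (simp add: card_image[OF inj] t_def)
qed

section \<open>Bruhat steps as exchanges of pairs\<close>

lemma bruhat_stepI:
  assumes "w permutes {1..m}" "a \<in> {1..m}" "b \<in> {1..m}" "a < b" "w a < w b"
  shows "bruhat_step m w (w \<circ> transpose a b)"
proof -
  have v: "w \<circ> transpose a b permutes {1..m}"
    using permutes_compose[OF permutes_swap_id[OF assms(2,3)] assms(1)] .
  have "cox_length m w < cox_length m (w \<circ> transpose a b)"
    using card_inversions_transpose[OF assms(2-5)]
    unfolding cox_length_eq_inversions[OF assms(1)] cox_length_eq_inversions[OF v] .
  then show ?thesis
    unfolding bruhat_step_def using assms(1-4)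
    by (intro conjI bexI[of _ a] bexI[of _ b]) auto
qed

lemma bruhat_stepE:
  assumes "bruhat_step m u w"
  obtains a b where "u permutes {1..m}" "w permutes {1..m}" "a \<in> {1..m}" "b \<in> {1..m}" "a < b"
    "w b < w a" "u = w \<circ> transpose a b"
proof -
  obtain a b where u: "u permutes {1..m}" and a: "a \<in> {1..m}" and b: "b \<in> {1..m}" and ne: "a \<noteq> b"
    and w: "w = u \<circ> transpose a b" and len: "cox_length m u < cox_length m w"
    using assms by (auto simp: bruhat_step_def)
  have wp: "w permutes {1..m}"
    unfolding w by (rule permutes_compose[OF permutes_swap_id[OF a b] u])
  have uw: "u = w \<circ> transpose a b" by (simp add: w comp_assoc)
  define p q where "p = min a b" and "q = max a b"
  have pq: "p \<in> {1..m}" "q \<in> {1..m}" "p < q" "transpose a b = transpose p q"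
    using a b ne by (auto simp: p_def q_def min_def max_def transpose_commute)
  \<comment> \<open>Otherwise the exchange that turns \<open>w\<close> into \<open>u\<close> would
    raise the number of inversions, against \<open>len\<close>.\<close>
  have "\<not> w p < w q"
    using card_inversions_transpose[OF pq(1-3), of w] len u wp uw pq(4)
    by (auto simp: cox_length_eq_inversions)
  moreover have "w p \<noteq> w q" using pq(3) inj_eq[OF permutes_inj[OF wp]] by auto
  ultimately show ?thesis using that[OF u wp pq(1-3)] uw pq(4) by auto
qed

section \<open>Dellac configurations\<close>

lemma W_J_permutes_block:
  assumes "v \<in> W_J N"
  shows "v permutes {1..2 * N} \<and> (\<forall>i. (v i + 1) div 2 = (i + 1) div 2)"
  using assms unfolding W_J_def
proof (induction rule: generate.induct)
  case one
  show ?case using permutes_id by (simp add: sym_group_one id_def)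
next
  case (incl h)
  then obtain k where k: "k \<in> {1..N}" and h: "h = transpose (2 * k - 1) (2 * k)" by auto
  have "h permutes {1..2 * N}" unfolding h using k by (intro permutes_swap_id) auto
  moreover have "(h i + 1) div 2 = (i + 1) div 2" for i
    using k by (auto simp: h transpose_def)
  ultimately show ?case by blast
next
  case (inv h)
  then obtain k where k: "k \<in> {1..N}" and h: "h = transpose (2 * k - 1) (2 * k)" by auto
  have h_perm: "h permutes {1..2 * N}" unfolding h using k by (intro permutes_swap_id) auto
  then have "inv\<^bsub>sym_group (2 * N)\<^esub> h = h"
    by (simp add: sym_group_carrier h)
  moreover have "(h i + 1) div 2 = (i + 1) div 2" for i
    using k by (auto simp: h transpose_def)
  ultimately show ?case using h_perm by simp
next
  case (eng h1 h2)
  then have "h1 \<circ> h2 permutes {1..2 * N}" by (blast intro: permutes_compose)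
  with eng show ?case by (simp add: sym_group_mult comp_def)
qed

text \<open>\<open>(i + 1) div 2\<close> numbers the pairs of positions \<open>2 * k - 1\<close>,
  \<open>2 * k\<close>, which \<open>W_J\<close> preserves. By \<open>asc\<close> no inversion of
  \<open>w\<close> lies within a pair, and between different pairs the inverse of \<open>h\<close>
  keeps the order of positions. So this inverse embeds the inversions of \<open>w\<close> into those
  of \<open>w \<circ> h\<close>.\<close>

lemma min_repsI:
  assumes w: "w permutes {1..2 * N}"
    and asc: "\<And>k. k \<in> {1..N} \<Longrightarrow> w (2 * k - 1) < w (2 * k)"
  shows "w \<in> min_reps N"
proof -
  have "cox_length (2 * N) w \<le> cox_length (2 * N) (w \<circ> h)" if h: "h \<in> W_J N" for h
  proof -
    have h_perm: "h permutes {1..2 * N}" and block: "(h i + 1) div 2 = (i + 1) div 2" for i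
      using W_J_permutes_block[OF h] by auto
    define g where "g = inv' h"
    have g: "g permutes {1..2 * N}" unfolding g_def by (rule permutes_inv[OF h_perm])
    have hg: "h (g i) = i" for i using permutes_inverses(1)[OF h_perm] by (simp add: g_def)
    have block_g: "(g i + 1) div 2 = (i + 1) div 2" for i using block[of "g i"] hg by simp
    have "(g p, g q) \<in> inversions (2 * N) (w \<circ> h)" if pq: "(p, q) \<in> inversions (2 * N) w" for p q
    proof -
      have "(p + 1) div 2 \<noteq> (q + 1) div 2"
      proof
        assume eq: "(p + 1) div 2 = (q + 1) div 2"
        define k where "k = (p + 1) div 2"
        from pq eq have "p = 2 * k - 1" "q = 2 * k" "k \<in> {1..N}"
          by (auto simp: inversions_def k_def)
        with asc[of k] pq show False by (auto simp: inversions_def)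
      qed
      moreover have "(p + 1) div 2 \<le> (q + 1) div 2"
        using pq by (auto simp: inversions_def intro: div_le_mono)
      ultimately have "g p < g q"
        using block_g[of p] block_g[of q] by (metis add_le_mono1 div_le_mono le_antisym not_le_imp_less)
      then show ?thesis
        using pq permutes_in_image[OF g, of p] permutes_in_image[OF g, of q]
        by (simp add: inversions_def hg)
    qed
    then have "map_prod g g ` inversions (2 * N) w \<subseteq> inversions (2 * N) (w \<circ> h)" by auto
    then have "card (map_prod g g ` inversions (2 * N) w) \<le> card (inversions (2 * N) (w \<circ> h))"
      by (rule card_mono[OF finite_inversions])
    moreover have "inj_on (map_prod g g) (inversions (2 * N) w)"
      using prod.inj_map[OF permutes_inj[OF g] permutes_inj[OF g]] by (rule inj_on_subset) simp
    ultimately have "card (inversions (2 * N) w) \<le> card (inversions (2 * N) (w \<circ> h))"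
      by (simp add: card_image)
    then show ?thesis
      unfolding cox_length_eq_inversions[OF w]
        cox_length_eq_inversions[OF permutes_compose[OF h_perm w]] .
  qed
  then show ?thesis
    using w by (auto simp: min_reps_def sym_group_carrier l_coset_def sym_group_mult)
qed

text \<open>The one-line notation of a Dellac configuration read row by row: row \<open>k\<close>
  has its columns at the positions \<open>2 * k - 1\<close> and \<open>2 * k\<close>. As they are in
  increasing order, one bound for each suffices.\<close>

definition dellac_perm :: "nat \<Rightarrow> (nat \<Rightarrow> nat) \<Rightarrow> bool" where
  "dellac_perm N \<sigma> \<longleftrightarrow> \<sigma> permutes {1..2 * N} \<and>
     (\<forall>k\<in>{1..N}. k \<le> \<sigma> (2 * k - 1) \<and> \<sigma> (2 * k - 1) < \<sigma> (2 * k) \<and> \<sigma> (2 * k) \<le> N + k)"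

lemma dellac_permD:
  assumes "dellac_perm N \<sigma>"
  shows "\<sigma> permutes {1..2 * N}"
    and "k \<in> {1..N} \<Longrightarrow> k \<le> \<sigma> (2 * k - 1)"
    and "k \<in> {1..N} \<Longrightarrow> \<sigma> (2 * k - 1) < \<sigma> (2 * k)"
    and "k \<in> {1..N} \<Longrightarrow> \<sigma> (2 * k) \<le> N + k"
  using assms by (auto simp: dellac_perm_def)

text \<open>The even positions already take all values above \<open>N\<close>. The odd ones
  therefore permute \<open>{1..N}\<close>, and a permutation with \<open>k \<le> p k\<close>
  throughout is the identity.\<close>

lemma dellac_perm_eq_tau:
  assumes d: "dellac_perm N \<sigma>" and top: "\<And>k. k \<in> {1..N} \<Longrightarrow> \<sigma> (2 * k) = N + k"
  shows "\<sigma> = tau_perm N"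
proof -
  note perm = dellac_permD(1)[OF d]
  have inj: "\<sigma> x = \<sigma> y \<longleftrightarrow> x = y" for x y using permutes_inj[OF perm] by (simp add: inj_eq)
  define p where "p = (\<lambda>k. if k \<in> {1..N} then \<sigma> (2 * k - 1) else k)"
  have le: "\<sigma> (2 * k - 1) \<le> N" if k: "k \<in> {1..N}" for k
  proof (rule ccontr)
    assume gt: "\<not> ?thesis"
    define j where "j = \<sigma> (2 * k - 1) - N"
    have "\<sigma> (2 * k - 1) \<in> {1..2 * N}"
      using k by (subst permutes_in_image[OF perm]) auto
    then have "j \<in> {1..N}" "N + j = \<sigma> (2 * k - 1)" using gt by (auto simp: j_def)
    then have "\<sigma> (2 * j) = \<sigma> (2 * k - 1)" using top by simp
    then show False using k inj by (simp, presburger)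
  qed
  have p_in: "p ` {1..N} \<subseteq> {1..N}"
    using le dellac_permD(2)[OF d] by (fastforce simp: p_def)
  have p_inj: "inj_on p {1..N}" by (auto simp: inj_on_def p_def inj)
  have "bij_betw p {1..N} {1..N}"
    using endo_inj_surj[OF _ p_in p_inj] p_inj by (simp add: bij_betw_def)
  then have "p permutes {1..N}" by (rule bij_imp_permutes) (auto simp: p_def)
  then have "p = id"
    by (rule permutes_natset_ge) (use dellac_permD(2)[OF d] in \<open>auto simp: p_def\<close>)
  then have bot: "\<sigma> (2 * k - 1) = k" if "k \<in> {1..N}" for k
    using that by (auto simp: p_def fun_eq_iff split: if_splits)
  show ?thesis
  proof
    fix i
    consider "i \<notin> {1..2 * N}" | k where "k \<in> {1..N}" "i = 2 * k" | k where "k \<in> {1..N}" "i = 2 * k - 1"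
    proof -
      have "i \<in> {1..2 * N} \<Longrightarrow> \<exists>k\<in>{1..N}. i = 2 * k \<or> i = 2 * k - 1"
        by (rule bexI[of _ "(i + 1) div 2"]) auto
      then show ?thesis using that by blast
    qed
    then show "\<sigma> i = tau_perm N i"
    proof cases
      case 1
      then show ?thesis using permutes_not_in[OF perm 1] by (auto simp: tau_perm_def)
    next
      case 2
      then show ?thesis using top by (simp add: tau_perm_def)
    next
      case 3
      then have "odd i" "(i + 1) div 2 = k" by auto
      then show ?thesis using bot[of k] 3 by (auto simp: tau_perm_def)
    qed
  qed
qed

text \<open>In the first row \<open>k\<close> whose larger column \<open>b\<close> is not maximal,
  \<open>b\<close> is exchanged with a column between \<open>b + 1\<close> and \<open>N + k\<close>
  from a later row. A pigeonhole argument finds such a column in one of the rows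
  \<open>k + 1\<close> to \<open>b\<close>, the later rows whose lower bound admits column
  \<open>b\<close>.\<close>

lemma dellac_perm_bruhat_step:
  assumes d: "dellac_perm N \<sigma>" and ne: "\<sigma> \<noteq> tau_perm N"
  shows "\<exists>v. dellac_perm N v \<and> bruhat_step (2 * N) \<sigma> v"
proof -
  note perm = dellac_permD(1)[OF d]
  have inj: "\<sigma> x = \<sigma> y \<longleftrightarrow> x = y" for x y using permutes_inj[OF perm] by (simp add: inj_eq)
  define bad where "bad k \<longleftrightarrow> k \<in> {1..N} \<and> \<sigma> (2 * k) \<noteq> N + k" for k
  define k where "k = (LEAST k. bad k)"
  have "\<exists>k. bad k" using dellac_perm_eq_tau[OF d] ne by (auto simp: bad_def)
  then have "bad k" unfolding k_def by (rule LeastI_ex)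
  then have k: "k \<in> {1..N}" and "\<sigma> (2 * k) \<noteq> N + k" by (simp_all add: bad_def)
  have earlier: "\<sigma> (2 * j) = N + j" if "j \<in> {1..<k}" for j
    using not_less_Least[of j bad] that k by (auto simp: bad_def k_def)
  define b where "b = \<sigma> (2 * k)"
  have b_less: "b < N + k" using dellac_permD(4)[OF d k] \<open>\<sigma> (2 * k) \<noteq> N + k\<close> by (simp add: b_def)
  \<comment> \<open>The earlier rows occupy the columns \<open>N + 1\<close> to
    \<open>N + k - 1\<close>, which leaves no place for \<open>b\<close> above \<open>N\<close>.
    Consequently the rows up to \<open>b\<close> exist.\<close>
  have b_le: "b \<le> N"
  proof (rule ccontr)
    assume gt: "\<not> b \<le> N"
    then have "b - N \<in> {1..<k}" "N + (b - N) = b" using b_less by auto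
    then have "\<sigma> (2 * (b - N)) = b" using earlier by simp
    then have "2 * (b - N) = 2 * k" by (simp add: b_def inj)
    then show False using b_less gt by auto
  qed
  have k_less: "k < b" using dellac_permD(2,3)[OF d k] by (simp add: b_def)
  define P where "P = {2 * k + 1..2 * b}"
  have "\<exists>q\<in>P. b < \<sigma> q \<and> \<sigma> q \<le> N + k"
  proof (rule ccontr)
    \<comment> \<open>Then the \<open>2 * (b - k)\<close> distinct values at the positions in
      \<open>P\<close> would have to fit into \<open>(b - k - 1) + (b - k)\<close> columns.\<close>
    assume none: "\<not> ?thesis"
    have "\<sigma> ` P \<subseteq> {k + 1..b - 1} \<union> {N + k + 1..N + b}"
    proof
      fix x assume "x \<in> \<sigma> ` P"
      then obtain q where q: "q \<in> P" and x: "x = \<sigma> q" by blast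
      define r where "r = (q + 1) div 2"
      have r: "r \<in> {k + 1..b}" "r \<in> {1..N}" and q_cases: "q = 2 * r \<or> q = 2 * r - 1"
        using q b_le by (auto simp: P_def r_def)
      have "r \<le> x" "x \<le> N + r"
        using q_cases dellac_permD(2-4)[OF d r(2)] by (auto simp: x)
      moreover have "x \<noteq> b" using q by (auto simp: x b_def inj P_def)
      moreover have "x \<le> b \<or> N + k < x" using none q x by force
      ultimately show "x \<in> {k + 1..b - 1} \<union> {N + k + 1..N + b}" using r by auto
    qed
    then have "card (\<sigma> ` P) \<le> card ({k + 1..b - 1} \<union> {N + k + 1..N + b})"
      by (intro card_mono) auto
    also have "\<dots> \<le> card {k + 1..b - 1} + card {N + k + 1..N + b}" by (rule card_Un_le)
    also have "\<dots> < 2 * (b - k)" using k_less by simp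
    finally show False
      using card_image[OF inj_on_subset[OF permutes_inj[OF perm]], of P] by (simp add: P_def)
  qed
  then obtain q0 where q0: "q0 \<in> P" "b < \<sigma> q0" "\<sigma> q0 \<le> N + k" by blast
  define r where "r = (q0 + 1) div 2"
  have r: "k < r" "r \<le> b" "r \<in> {1..N}" and q0_cases: "q0 = 2 * r \<or> q0 = 2 * r - 1"
    using q0(1) b_le by (auto simp: P_def r_def)
  have "\<sigma> (2 * r - 1) \<noteq> b" using r by (auto simp: b_def inj)
  \<comment> \<open>Row \<open>r\<close> must stay increasing after it receives \<open>b\<close>. If
    both of its columns exceed \<open>b\<close>, the smaller one is taken, which satisfies the same
    bounds.\<close>
  obtain q where q: "b < \<sigma> q" "\<sigma> q \<le> N + k"
    and q_cases: "q = 2 * r - 1 \<or> q = 2 * r \<and> \<sigma> (2 * r - 1) < b"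
  proof (cases "q0 = 2 * r \<and> b < \<sigma> (2 * r - 1)")
    case True
    then show ?thesis using that[of "2 * r - 1"] dellac_permD(3)[OF d r(3)] q0 by simp
  next
    case False
    then show ?thesis using that[of q0] q0 q0_cases \<open>\<sigma> (2 * r - 1) \<noteq> b\<close> by auto
  qed
  have q_bounds: "2 * k < q" "q \<in> {1..2 * N}" using q_cases r by auto
  define v where "v = \<sigma> \<circ> transpose (2 * k) q"
  have "bruhat_step (2 * N) \<sigma> v"
    unfolding v_def using k q q_bounds by (intro bruhat_stepI[OF perm]) (auto simp: b_def)
  moreover have "dellac_perm N v"
    unfolding dellac_perm_def
  proof (intro conjI ballI)
    show "v permutes {1..2 * N}"
      unfolding v_def using k q_bounds by (intro permutes_compose[OF permutes_swap_id perm]) auto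
    fix j assume j: "j \<in> {1..N}"
    note dj = dellac_permD(2-4)[OF d j]
    consider "j = k" | "j = r" | "j \<noteq> k" "j \<noteq> r" by blast
    then have "j \<le> v (2 * j - 1) \<and> v (2 * j - 1) < v (2 * j) \<and> v (2 * j) \<le> N + j"
    proof cases
      case 1
      have "v (2 * k) = \<sigma> q" by (simp add: v_def)
      moreover have "v (2 * k - 1) = \<sigma> (2 * k - 1)"
        using q_bounds k by (auto simp: v_def transpose_def)
      ultimately show ?thesis using 1 dj q b_def by auto
    next
      case 2
      have vq: "v q = b" by (simp add: v_def b_def)
      show ?thesis
      proof (cases "q = 2 * r - 1")
        case True
        then have "v (2 * r) = \<sigma> (2 * r)" using r by (auto simp: v_def transpose_def)
        then show ?thesis using True vq 2 r dj q by auto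
      next
        case False
        then have qr: "q = 2 * r" "\<sigma> (2 * r - 1) < b" using q_cases by auto
        have "2 * r - 1 \<noteq> 2 * k" using r by presburger
        then have "v (2 * r - 1) = \<sigma> (2 * r - 1)" using r qr by (auto simp: v_def transpose_def)
        then show ?thesis using qr vq 2 r dj b_less by auto
      qed
    next
      case 3
      have "v (2 * j) = \<sigma> (2 * j)" "v (2 * j - 1) = \<sigma> (2 * j - 1)"
        using 3 j r q_cases by (auto simp: v_def transpose_def; presburger)+
      then show ?thesis using dj by simp
    qed
    then show "j \<le> v (2 * j - 1)" "v (2 * j - 1) < v (2 * j)" "v (2 * j) \<le> N + j" by auto
  qed
  ultimately show ?thesis by blast
qed

text \<open>Each upward exchange raises the number of inversions, which is bounded, so repeating it
  must end, and it can end only at \<open>tau_perm\<close>.\<close>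

lemma dellac_perm_le_tau:
  assumes "dellac_perm N \<sigma>"
  shows "bruhat_le (2 * N) \<sigma> (tau_perm N)"
  using assms
proof (induction "2 * N * (2 * N) - card (inversions (2 * N) \<sigma>)" arbitrary: \<sigma> rule: less_induct)
  case less
  show ?case
  proof (cases "\<sigma> = tau_perm N")
    case True
    then show ?thesis by (simp add: bruhat_le_def)
  next
    case False
    then obtain v where v: "dellac_perm N v" and step: "bruhat_step (2 * N) \<sigma> v"
      using dellac_perm_bruhat_step[OF less.prems] by blast
    have "card (inversions (2 * N) \<sigma>) < card (inversions (2 * N) v)"
      using step cox_length_eq_inversions[OF dellac_permD(1)[OF v]]
        cox_length_eq_inversions[OF dellac_permD(1)[OF less.prems]]
      by (auto simp: bruhat_step_def)
    then have "bruhat_le (2 * N) v (tau_perm N)"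
      using less.hyps[OF _ v] card_inversions_le[of "2 * N" v] by linarith
    then show ?thesis using step by (auto simp: bruhat_le_def)
  qed
qed

lemma dellac_perm_min_reps_le_tau: "dellac_perm N \<sigma> \<Longrightarrow> \<sigma> \<in> min_reps_le_tau N"
  using min_repsI[of \<sigma> N] dellac_permD(1,3)[of N \<sigma>] by (simp add: min_reps_le_tau_def dellac_perm_le_tau)

section \<open>From boards to permutations\<close>

lemma b_map_row:
  assumes C: "C \<in> dellac (n + 1)" and k: "k \<in> {1..n + 1}"
  shows "b_map n C (2 * k - 1) < b_map n C (2 * k)"
    and "{b_map n C (2 * k - 1), b_map n C (2 * k)} = {j. (k, j) \<in> C}"
proof -
  let ?R = "{j. (k, j) \<in> C}"
  have "card ?R = 2" using C k by (auto simp: dellac_def)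
  then obtain x y where R: "?R = {x, y}" "x \<noteq> y" by (auto simp: card_2_iff)
  have "odd (2 * k - 1)" "(2 * k - 1 + 1) div 2 = k" "2 * k - 1 \<in> {1..2 * n + 2}" using k by auto
  then have lo: "b_map n C (2 * k - 1) = Min ?R" by (simp add: b_map_def)
  have hi: "b_map n C (2 * k) = Max ?R" using k by (simp add: b_map_def)
  show "b_map n C (2 * k - 1) < b_map n C (2 * k)"
    unfolding lo hi R(1) using R(2) by (auto simp: min_def max_def)
  show "{b_map n C (2 * k - 1), b_map n C (2 * k)} = ?R"
    unfolding lo hi R(1) by (auto simp: min_def max_def)
qed

text \<open>Position \<open>i\<close> carries a column marked in row \<open>(i + 1) div 2\<close>. A
  column has only one marked row, and the two columns of a row differ; this gives
  injectivity.\<close>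

lemma dellac_perm_b_map:
  assumes C: "C \<in> dellac (n + 1)"
  shows "dellac_perm (n + 1) (b_map n C)"
proof -
  let ?\<sigma> = "b_map n C"
  have bounds: "i \<le> j \<and> j \<le> n + 1 + i" "j \<in> {1..2 * (n + 1)}" if "(i, j) \<in> C" for i j
    using C that by (auto simp: dellac_def)
  have col_unique: "i = i'" if ij: "(i, j) \<in> C" "(i', j) \<in> C" for i i' j
  proof -
    have "card {i. (i, j) \<in> C} = 1" using C bounds(2)[OF ij(1)] by (auto simp: dellac_def)
    then show ?thesis using ij by (metis (no_types, lifting) card_1_singletonE mem_Collect_eq singletonD)
  qed
  have row: "(k, ?\<sigma> (2 * k - 1)) \<in> C" "(k, ?\<sigma> (2 * k)) \<in> C" if "k \<in> {1..n + 1}" for k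
    using b_map_row(2)[OF C that] by auto
  have pos: "((i + 1) div 2, ?\<sigma> i) \<in> C" if i: "i \<in> {1..2 * (n + 1)}" for i
  proof (cases "odd i")
    case True
    have "(i + 1) div 2 \<in> {1..n + 1}" "2 * ((i + 1) div 2) - 1 = i"
      using i True by (auto elim!: oddE)
    then show ?thesis using row(1)[of "(i + 1) div 2"] by simp
  next
    case False
    then have "(i + 1) div 2 \<in> {1..n + 1}" "2 * ((i + 1) div 2) = i" using i by auto
    then show ?thesis using row(2)[of "(i + 1) div 2"] by simp
  qed
  have inj: "inj_on ?\<sigma> {1..2 * (n + 1)}"
  proof (rule inj_onI)
    fix i j assume i: "i \<in> {1..2 * (n + 1)}" and j: "j \<in> {1..2 * (n + 1)}" and eq: "?\<sigma> i = ?\<sigma> j"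
    define k where "k = (i + 1) div 2"
    have k: "k \<in> {1..n + 1}" using i by (auto simp: k_def)
    have "(i + 1) div 2 = (j + 1) div 2" using pos[OF i] pos[OF j] eq col_unique by simp
    then have "i \<in> {2 * k - 1, 2 * k}" "j \<in> {2 * k - 1, 2 * k}" using i j by (auto simp: k_def)
    then show "i = j" using b_map_row(1)[OF C k] eq by auto
  qed
  have sub: "?\<sigma> ` {1..2 * (n + 1)} \<subseteq> {1..2 * (n + 1)}" using pos bounds(2) by blast
  have "bij_betw ?\<sigma> {1..2 * (n + 1)} {1..2 * (n + 1)}"
    using endo_inj_surj[OF _ sub inj] inj by (simp add: bij_betw_def)
  then have "?\<sigma> permutes {1..2 * (n + 1)}"
    by (rule bij_imp_permutes) (auto simp: b_map_def)
  then show ?thesis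
    using row bounds(1) b_map_row(1)[OF C] by (auto simp: dellac_perm_def)
qed

section \<open>Subspaces fixed by the torus\<close>

text \<open>The spans in \<open>coord_subspaces\<close> in terms of vanishing coordinates, which
  makes the action of a matrix on them an entrywise matter. \<open>Suc\<close> translates between
  the two ways of numbering.\<close>

definition coord_space :: "nat \<Rightarrow> nat set \<Rightarrow> complex vec set" where
  "coord_space m S = {v \<in> carrier_vec m. \<forall>i<m. v $ i \<noteq> 0 \<longrightarrow> Suc i \<in> S}"

lemma basis_vec_carrier [simp]: "basis_vec m i \<in> carrier_vec m"
  by (simp add: basis_vec_def)

lemma basis_vec_index:
  "j < m \<Longrightarrow> basis_vec m i $ j = (if j = i - 1 then 1 else 0)"
  by (simp add: basis_vec_def unit_vec_def)

lemma inj_on_basis_vec: "inj_on (basis_vec m) {1..m}"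
proof (rule inj_onI)
  fix i j assume i: "i \<in> {1..m}" and j: "j \<in> {1..m}" and "basis_vec m i = basis_vec m j"
  then have "basis_vec m j $ (i - 1) = 1" using basis_vec_index[of "i - 1" m i] i by auto
  moreover have "i - 1 < m" using i by auto
  ultimately have "i - 1 = j - 1" by (simp add: basis_vec_index split: if_splits)
  then show "i = j" using i j by auto
qed

lemma lincomb_basis_vec_index:
  assumes S: "S \<subseteq> {1..m}" and i: "i < m"
  shows "LinearCombinations.module.lincomb (cspace m) a (basis_vec m ` S) $ i =
    (if Suc i \<in> S then a (basis_vec m (Suc i)) else 0)"
proof -
  interpret vec_space "TYPE(complex)" m .
  have fin: "finite S" using S finite_subset by blast
  have "lincomb a (basis_vec m ` S) $ i = (\<Sum>x\<in>basis_vec m ` S. a x * x $ i)"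
    using i by (intro lincomb_index) auto
  also have "\<dots> = (\<Sum>j\<in>S. a (basis_vec m j) * basis_vec m j $ i)"
    by (rule sum.reindex_cong[OF inj_on_subset[OF inj_on_basis_vec S]]) auto
  also have "\<dots> = (\<Sum>j\<in>S. if j = Suc i then a (basis_vec m (Suc i)) else 0)"
    using S i by (intro sum.cong) (auto simp: basis_vec_index)
  also have "\<dots> = (if Suc i \<in> S then a (basis_vec m (Suc i)) else 0)"
    using fin by (simp add: sum.delta)
  finally show ?thesis .
qed

lemma span_basis_vec:
  assumes S: "S \<subseteq> {1..m}"
  shows "LinearCombinations.module.span class_ring (cspace m) (basis_vec m ` S) = coord_space m S"
proof -
  interpret vec_space "TYPE(complex)" m .
  have fin: "finite (basis_vec m ` S)" using S finite_subset by blast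
  have carr: "basis_vec m ` S \<subseteq> carrier_vec m" by auto
  show ?thesis
  proof (intro equalityI subsetI)
    fix v assume "v \<in> span (basis_vec m ` S)"
    then obtain a where v: "v = lincomb a (basis_vec m ` S)"
      using finite_in_span[OF fin carr] by auto
    have "v \<in> carrier_vec m" unfolding v by (rule lincomb_closed[OF carr])
    then show "v \<in> coord_space m S"
      using lincomb_basis_vec_index[OF S] by (auto simp: coord_space_def v)
  next
    fix v assume v: "v \<in> coord_space m S"
    \<comment> \<open>Coefficients in \<open>lincomb\<close> are attached to vectors and not to
      indices; the scalar product with a basis vector reads off the coordinate of
      \<open>v\<close>.\<close>
    define a where "a u = u \<bullet> v" for u
    have a: "a (basis_vec m (Suc i)) = v $ i" if "i < m" for i
      using v that by (simp add: a_def basis_vec_def coord_space_def)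
    have "v = lincomb a (basis_vec m ` S)"
    proof (rule eq_vecI)
      have len: "dim_vec (lincomb a (basis_vec m ` S)) = m"
        using lincomb_closed[OF carr, of a] by auto
      show "dim_vec v = dim_vec (lincomb a (basis_vec m ` S))"
        using v len by (simp add: coord_space_def)
      fix i assume "i < dim_vec (lincomb a (basis_vec m ` S))"
      then have "i < m" using len by simp
      then show "v $ i = lincomb a (basis_vec m ` S) $ i"
        using lincomb_basis_vec_index[OF S, of i a] a v by (auto simp: coord_space_def)
    qed
    then show "v \<in> span (basis_vec m ` S)"
      using finite_span[OF fin carr] by auto
  qed
qed

lemma coord_subspaces_eq:
  assumes "k \<in> {1..n}" "I k \<subseteq> {1..m}"
  shows "coord_subspaces m n I k = coord_space m (I k)"
  using assms by (simp add: coord_subspaces_def span_basis_vec)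

lemma act_coord_subspacesI:
  assumes "\<And>k. k \<in> {1..n} \<Longrightarrow> I k \<subseteq> {1..m}" "\<And>k. k \<in> {1..n} \<Longrightarrow> I' k \<subseteq> {1..m}"
    and "\<And>k. k \<in> {1..n} \<Longrightarrow> (\<lambda>v. A *\<^sub>v v) ` coord_space m (I k) = coord_space m (I' k)"
  shows "act n A (coord_subspaces m n I) = coord_subspaces m n I'"
proof
  fix k
  show "act n A (coord_subspaces m n I) k = coord_subspaces m n I' k"
  proof (cases "k \<in> {1..n}")
    case True
    then show ?thesis
      using assms[of k] coord_subspaces_eq[of k n I m] coord_subspaces_eq[of k n I' m]
      by (simp add: act_def)
  qed (auto simp: act_def coord_subspaces_def)
qed

lemma act_mult:
  assumes "A \<in> carrier_mat m m" "B \<in> carrier_mat m m"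
    and "\<And>k. k \<in> {1..n} \<Longrightarrow> V k \<subseteq> carrier_vec m"
  shows "act n (A * B) V = act n A (act n B V)"
proof
  fix k
  show "act n (A * B) V k = act n A (act n B V) k"
  proof (cases "k \<in> {1..n}")
    case True
    have "(A * B) *\<^sub>v v = A *\<^sub>v (B *\<^sub>v v)" if "v \<in> V k" for v
      using assms True that by (intro assoc_mult_mat_vec[of _ m m _ m]) auto
    then show ?thesis using True by (auto simp: act_def image_image intro!: image_cong)
  qed (auto simp: act_def)
qed

section \<open>Diagonal and elementary matrices acting on coordinate subspaces\<close>

lemma mult_mat_vec_index:
  assumes "A \<in> carrier_mat m m" "v \<in> carrier_vec m" "i < m"
  shows "(A *\<^sub>v v) $ i = (\<Sum>j<m. A $$ (i, j) * v $ j)"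
  using assms by (auto simp: scalar_prod_def atLeast0LessThan intro!: sum.cong)

lemma diagonal_mult_vec_index:
  assumes "A \<in> carrier_mat m m" "diagonal_mat A" "v \<in> carrier_vec m" "i < m"
  shows "(A *\<^sub>v v) $ i = A $$ (i, i) * v $ i"
proof -
  have "(A *\<^sub>v v) $ i = (\<Sum>j<m. if j = i then A $$ (i, i) * v $ i else 0)"
    unfolding mult_mat_vec_index[OF assms(1,3,4)]
    using assms by (intro sum.cong) (auto simp: diagonal_mat_def)
  then show ?thesis using assms(4) by simp
qed

lemma diag_torus_entry_nonzero:
  assumes "t \<in> diag_torus m" "i < m"
  shows "t $$ (i, i) \<noteq> 0"
proof -
  have t: "t \<in> carrier_mat m m" "det t = 1" "diagonal_mat t"
    using assms(1) by (auto simp: diag_torus_def SL_def)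
  have "upper_triangular t" using t(1,3) by (auto simp: diagonal_mat_def)
  then have "prod_list (diag_mat t) = 1" using det_upper_triangular[OF _ t(1)] t(2) by simp
  then have "0 \<notin> set (diag_mat t)" by (metis prod_list_zero_iff zero_neq_one)
  moreover have "t $$ (i, i) \<in> set (diag_mat t)"
    using assms(2) t(1) by (auto simp: diag_mat_def)
  ultimately show ?thesis by metis
qed

lemma diag_torus_coord_space:
  assumes t: "t \<in> diag_torus m"
  shows "(\<lambda>v. t *\<^sub>v v) ` coord_space m S = coord_space m S"
proof -
  have c: "t \<in> carrier_mat m m" "diagonal_mat t" using t by (auto simp: diag_torus_def SL_def)
  note ind = diagonal_mult_vec_index[OF c]
  note nz = diag_torus_entry_nonzero[OF t]
  show ?thesis
  proof (intro equalityI subsetI)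
    fix w assume "w \<in> (\<lambda>v. t *\<^sub>v v) ` coord_space m S"
    then show "w \<in> coord_space m S" using c(1) ind by (auto simp: coord_space_def)
  next
    fix w assume w: "w \<in> coord_space m S"
    define v where "v = vec m (\<lambda>i. w $ i / t $$ (i, i))"
    have v: "v \<in> carrier_vec m" by (simp add: v_def)
    have "v \<in> coord_space m S" using w nz by (auto simp: coord_space_def v_def)
    moreover have "w = t *\<^sub>v v"
    proof (rule eq_vecI)
      show "dim_vec w = dim_vec (t *\<^sub>v v)" using w c(1) by (auto simp: coord_space_def)
      fix i assume "i < dim_vec (t *\<^sub>v v)"
      then have "i < m" using c(1) by simp
      then show "w $ i = (t *\<^sub>v v) $ i" using ind[OF v] nz by (simp add: v_def)
    qed
    ultimately show "w \<in> (\<lambda>v. t *\<^sub>v v) ` coord_space m S" by blast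
  qed
qed

lemma diag_torus_act_coord_subspaces:
  assumes "t \<in> diag_torus m" "\<And>k. k \<in> {1..n} \<Longrightarrow> I k \<subseteq> {1..m}"
  shows "act n t (coord_subspaces m n I) = coord_subspaces m n I"
  using assms diag_torus_coord_space by (intro act_coord_subspacesI) auto

lemma addrow_mat_mult_vec_index:
  assumes "k < m" "l < m" "k \<noteq> l" "v \<in> carrier_vec m" "i < m"
  shows "(addrow_mat m c k l *\<^sub>v v) $ i = v $ i + (if i = k then c * v $ l else 0)"
proof -
  have "(addrow_mat m c k l *\<^sub>v v) $ i = (\<Sum>j<m. addrow_mat m c k l $$ (i, j) * v $ j)"
    by (rule mult_mat_vec_index) (use assms in auto)
  also have "\<dots> = (\<Sum>j<m. (if j = i then v $ i else 0) + (if j = l then (if i = k then c * v $ l else 0) else 0))"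
    using assms by (intro sum.cong) auto
  also have "\<dots> = v $ i + (if i = k then c * v $ l else 0)"
    using assms by (simp add: sum.distrib sum.delta)
  finally show ?thesis .
qed

text \<open>A multiple of coordinate \<open>l\<close> is added to coordinate \<open>k\<close>, which
  \<open>S\<close> allows. The inverse matrix has the same shape with \<open>- c\<close>, so the
  inclusion for all coefficients gives equality.\<close>

lemma addrow_mat_coord_space:
  assumes kl: "k < m" "l < m" "k \<noteq> l" and S: "Suc l \<in> S \<Longrightarrow> Suc k \<in> S"
  shows "(\<lambda>v. addrow_mat m c k l *\<^sub>v v) ` coord_space m S = coord_space m S"
proof -
  have sub: "addrow_mat m d k l *\<^sub>v v \<in> coord_space m S" if v: "v \<in> coord_space m S" for d v
  proof -
    have vc: "v \<in> carrier_vec m" using v by (simp add: coord_space_def)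
    have "Suc i \<in> S" if i: "i < m" and nz: "(addrow_mat m d k l *\<^sub>v v) $ i \<noteq> 0" for i
      using nz v kl S i unfolding addrow_mat_mult_vec_index[OF kl vc i] coord_space_def
      by (cases "v $ i = 0"; cases "v $ l = 0") (auto split: if_splits)
    then show ?thesis
      using mult_mat_vec_carrier[OF addrow_mat_carrier vc] by (simp add: coord_space_def)
  qed
  have "v \<in> (\<lambda>v. addrow_mat m c k l *\<^sub>v v) ` coord_space m S" if v: "v \<in> coord_space m S" for v
  proof -
    have "addrow_mat m c k l *\<^sub>v (addrow_mat m (- c) k l *\<^sub>v v) = 1\<^sub>m m *\<^sub>v v"
      using v kl by (subst assoc_mult_mat_vec[symmetric, of _ m m _ m])
        (auto simp: addrow_mat_inv coord_space_def)
    also have "\<dots> = v" using v by (simp add: coord_space_def)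
    finally show ?thesis using sub[OF v, of "- c"] by (intro rev_image_eqI) auto
  qed
  with sub show ?thesis by blast
qed

text \<open>A one-parameter subgroup belonging to a coroot: determinant 1 forces an entry
  \<open>1 / z\<close> at \<open>j\<close> to compensate for \<open>z\<close> at
  \<open>i\<close>.\<close>

definition torus_elem :: "nat \<Rightarrow> nat \<Rightarrow> nat \<Rightarrow> complex \<Rightarrow> complex mat" where
  "torus_elem m i j z = multrow_mat m i z * multrow_mat m j (1 / z)"

lemma torus_elem_eq:
  assumes "i < m" "j < m" "i \<noteq> j"
  shows "torus_elem m i j z = mat m m (\<lambda>(a, b). if a \<noteq> b then 0 else
    if a = i then z else if a = j then 1 / z else 1)"
  unfolding torus_elem_def
  by (subst multrow_mat[symmetric, of _ m m], simp, rule eq_matI) (use assms in auto)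

lemma torus_elem_in_diag_torus:
  assumes "i < m" "j < m" "i \<noteq> j" "z \<noteq> 0"
  shows "torus_elem m i j z \<in> diag_torus m"
proof -
  have "det (torus_elem m i j z) = z * (1 / z)"
    unfolding torus_elem_def using assms
    by (subst det_mult[of _ m]) (auto simp: det_multrow_mat)
  moreover have "diagonal_mat (torus_elem m i j z)"
    unfolding torus_elem_eq[OF assms(1-3)] by (auto simp: diagonal_mat_def)
  moreover have "torus_elem m i j z \<in> carrier_mat m m"
    unfolding torus_elem_eq[OF assms(1-3)] by simp
  ultimately show ?thesis using assms(4) by (simp add: diag_torus_def SL_def)
qed

text \<open>Induction on the size of the support of \<open>v\<close>: as long as another coordinate
  \<open>j\<close> is nonzero, a torus element that distinguishes \<open>i\<close> from
  \<open>j\<close> yields a vector of \<open>V\<close> with smaller support that still involves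
  \<open>i\<close>.\<close>

lemma fixed_subspace_contains_unit_vec:
  assumes V: "subspace class_ring V (cspace m)"
    and fixed: "\<And>t. t \<in> diag_torus m \<Longrightarrow> (\<lambda>v. t *\<^sub>v v) ` V = V"
    and "v \<in> V" "i < m" "v $ i \<noteq> 0"
  shows "unit_vec m i \<in> V"
  using assms(3-5)
proof (induction "card {j. j < m \<and> v $ j \<noteq> 0}" arbitrary: v rule: less_induct)
  case less
  interpret V: submodule class_ring V "cspace m" using V by (simp add: subspace_def)
  note v = less.prems(1) and i = less.prems(2,3)
  have vc: "x \<in> carrier_vec m" if "x \<in> V" for x
    using V.subset that by (auto simp: module_vec_simps)
  have add: "x + y \<in> V" if "x \<in> V" "y \<in> V" for x y
    using V.m_closed[OF that] by (simp add: module_vec_simps)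
  have smult: "c \<cdot>\<^sub>v x \<in> V" if "x \<in> V" for c x
    using V.smult_closed[OF _ that, of c] by (simp add: module_vec_simps)
  show ?case
  proof (cases "\<exists>j<m. j \<noteq> i \<and> v $ j \<noteq> 0")
    case True
    then obtain j where j: "j < m" "j \<noteq> i" "v $ j \<noteq> 0" by blast
    let ?t = "torus_elem m i j 2"
    have t: "?t \<in> diag_torus m" using i j by (intro torus_elem_in_diag_torus) auto
    then have tc: "?t \<in> carrier_mat m m" "diagonal_mat ?t" by (auto simp: diag_torus_def SL_def)
    \<comment> \<open>The entries 2 and 1 / 2 of \<open>?t\<close> differ, so subtracting half of
      \<open>v\<close> removes coordinate \<open>j\<close> but scales coordinate \<open>i\<close> by
      3 / 2.\<close>
    define w where "w = ?t *\<^sub>v v + (- 1 / 2) \<cdot>\<^sub>v v"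
    have "w \<in> V" unfolding w_def using fixed[OF t] v by (intro add smult) blast+
    have w: "w $ a = (if a = i then 3 / 2 else if a = j then 0 else 1 / 2) * v $ a"
      if "a < m" for a
    proof -
      have "w $ a = ?t $$ (a, a) * v $ a + (- 1 / 2) * v $ a"
        unfolding w_def using diagonal_mult_vec_index[OF tc vc[OF v] that] vc[OF v] tc(1) that by simp
      also have "\<dots> = (?t $$ (a, a) + - 1 / 2) * v $ a" by (simp only: distrib_right)
      also have "?t $$ (a, a) + - 1 / 2 = (if a = i then 3 / 2 else if a = j then 0 else 1 / 2)"
        using that i(1) j by (simp add: torus_elem_eq)
      finally show ?thesis .
    qed
    have "v $ a \<noteq> 0" if "a < m" "w $ a \<noteq> 0" for a
      using that(2) unfolding w[OF that(1)] by auto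
    moreover have "w $ j = 0" unfolding w[OF j(1)] using j(2) by simp
    ultimately have "{a. a < m \<and> w $ a \<noteq> 0} \<subset> {a. a < m \<and> v $ a \<noteq> 0}"
      using j by blast
    then have "card {a. a < m \<and> w $ a \<noteq> 0} < card {a. a < m \<and> v $ a \<noteq> 0}"
      by (intro psubset_card_mono) auto
    then show ?thesis using less.hyps[OF _ \<open>w \<in> V\<close> i(1)] w[OF i(1)] i by simp
  next
    case False
    have "unit_vec m i = (1 / v $ i) \<cdot>\<^sub>v v"
      using False vc[OF v] i by (intro eq_vecI) (auto simp: unit_vec_def)
    then show ?thesis using smult[OF v] by simp
  qed
qed

lemma fixed_subspace_eq_coord_space:
  assumes V: "subspace class_ring V (cspace m)"
    and fixed: "\<And>t. t \<in> diag_torus m \<Longrightarrow> (\<lambda>v. t *\<^sub>v v) ` V = V"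
  shows "V = coord_space m {i \<in> {1..m}. basis_vec m i \<in> V}" (is "V = coord_space m ?I")
proof -
  interpret vec_space "TYPE(complex)" m .
  have sm: "submodule class_ring V (cspace m)" using V by (simp add: subspace_def)
  have "V \<subseteq> carrier_vec m" using submodule.subset[OF sm] by (simp add: module_vec_simps)
  then have "V \<subseteq> coord_space m ?I"
    using fixed_subspace_contains_unit_vec[OF V fixed] by (auto simp: coord_space_def basis_vec_def)
  moreover have "span (basis_vec m ` ?I) \<subseteq> V"
    by (rule span_is_subset[OF _ sm]) auto
  moreover have "span (basis_vec m ` ?I) = coord_space m ?I" by (rule span_basis_vec) auto
  ultimately show ?thesis by (intro subset_antisym) (simp_all only:)
qed

lemma dim_coord_space:
  assumes S: "S \<subseteq> {1..m}"
  shows "vectorspace.dim class_ring ((cspace m)\<lparr>carrier := coord_space m S\<rparr>) = card S"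
proof -
  interpret vec_space "TYPE(complex)" m .
  let ?B = "basis_vec m ` S" and ?U = "coord_space m S"
  have fin: "finite ?B" using S finite_subset by blast
  have carr: "?B \<subseteq> carrier_vec m" by auto
  have sub: "VectorSpace.subspace class_ring ?U V"
    using span_is_subspace[of ?B] carr span_basis_vec[OF S] by simp
  have sm: "submodule class_ring ?U V" using sub by (simp add: subspace_def)
  have vsU: "vectorspace class_ring (vs ?U)" by (rule subspace_is_vs[OF sub])
  then interpret U: vectorspace class_ring "vs ?U" .
  have BU: "?B \<subseteq> ?U" using in_own_span[of ?B] carr span_basis_vec[OF S] by simp
  have "lin_indpt ?B"
  proof (rule finite_lin_indpt2[OF fin])
    show "?B \<subseteq> carrier_vec m" by (rule carr)
    fix a assume zero: "lincomb a ?B = 0\<^sub>v m"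
    show "\<forall>v\<in>?B. a v = 0"
    proof
      fix v assume "v \<in> ?B"
      then obtain i where i: "i \<in> S" "v = basis_vec m i" by blast
      then have "i \<in> {1..m}" using S by blast
      then have "i - 1 < m" "Suc (i - 1) = i" by auto
      then show "a v = 0"
        using lincomb_basis_vec_index[OF S, of "i - 1" a] zero i by simp
    qed
  qed
  then have "U.lin_indpt ?B" using span_li_not_depend(2)[OF BU sm] by simp
  moreover have "U.span ?B = ?U" using span_li_not_depend(1)[OF BU sm] span_basis_vec[OF S] by simp
  ultimately have "U.basis ?B" using BU by (simp add: U.basis_def)
  then have "U.dim = card ?B" by (rule U.dim_basis[OF fin])
  also have "\<dots> = card S" by (rule card_image[OF inj_on_subset[OF inj_on_basis_vec S]])
  finally show ?thesis .
qed

lemma fixed_Gr_card: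
  assumes "V \<in> Gr k m" and "\<And>t. t \<in> diag_torus m \<Longrightarrow> (\<lambda>v. t *\<^sub>v v) ` V = V"
  shows "card {i \<in> {1..m}. basis_vec m i \<in> V} = k"
proof -
  let ?I = "{i \<in> {1..m}. basis_vec m i \<in> V}"
  have V: "subspace class_ring V (cspace m)" and "vectorspace.dim class_ring ((cspace m)\<lparr>carrier := V\<rparr>) = k"
    using assms(1) by (auto simp: Gr_def)
  moreover have "V = coord_space m ?I" by (rule fixed_subspace_eq_coord_space[OF V assms(2)])
  moreover have "?I \<subseteq> {1..m}" by auto
  ultimately show ?thesis using dim_coord_space[of ?I m] by metis
qed

section \<open>Limits of Borel orbits\<close>

text \<open>A lift of \<open>w\<close> to matrices. The coefficients are left free because a
  permutation matrix may have determinant -1; as long as they are nonzero they do not affect the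
  action on coordinate subspaces.\<close>

definition monomial_mat :: "nat \<Rightarrow> (nat \<Rightarrow> nat) \<Rightarrow> (nat \<Rightarrow> complex) \<Rightarrow> complex mat" where
  "monomial_mat m w c = mat m m (\<lambda>(i, j). if Suc i = w (Suc j) then c j else 0)"

lemma monomial_mat_coord_space:
  assumes w: "w permutes {1..m}" and c: "\<And>j. c j \<noteq> 0" and S: "S \<subseteq> {1..m}"
  shows "(\<lambda>v. monomial_mat m w c *\<^sub>v v) ` coord_space m S = coord_space m (w ` S)"
proof -
  let ?A = "monomial_mat m w c"
  have A: "?A \<in> carrier_mat m m" by (simp add: monomial_mat_def)
  have pos: "w (Suc j) - 1 < m" "Suc (w (Suc j) - 1) = w (Suc j)" if "j < m" for j
  proof -
    have "w (Suc j) \<in> {1..m}" using that by (subst permutes_in_image[OF w]) auto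
    then show "w (Suc j) - 1 < m" "Suc (w (Suc j) - 1) = w (Suc j)" by auto
  qed
  have surj: "\<exists>j<m. Suc i = w (Suc j)" if "i < m" for i
  proof -
    have "Suc i \<in> w ` {1..m}" unfolding permutes_image[OF w] using that by auto
    then obtain k where "k \<in> {1..m}" "Suc i = w k" by blast
    then show ?thesis by (intro exI[of _ "k - 1"]) auto
  qed
  have inj: "w x = w y \<longleftrightarrow> x = y" for x y using permutes_inj[OF w] by (simp add: inj_eq)
  have ind: "(?A *\<^sub>v v) $ i = c j * v $ j"
    if v: "v \<in> carrier_vec m" and ij: "i < m" "j < m" "Suc i = w (Suc j)" for v i j
  proof -
    have "(?A *\<^sub>v v) $ i = (\<Sum>k<m. if k = j then c j * v $ j else 0)"
      unfolding mult_mat_vec_index[OF A v ij(1)]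
      using ij by (intro sum.cong) (auto simp: monomial_mat_def inj)
    then show ?thesis using ij by simp
  qed
  show ?thesis
  proof (intro equalityI subsetI)
    fix u assume "u \<in> (\<lambda>v. ?A *\<^sub>v v) ` coord_space m S"
    then obtain v where v: "v \<in> coord_space m S" and u: "u = ?A *\<^sub>v v" by blast
    have vc: "v \<in> carrier_vec m" using v by (simp add: coord_space_def)
    have "Suc i \<in> w ` S" if i: "i < m" and nz: "u $ i \<noteq> 0" for i
    proof -
      obtain j where j: "j < m" "Suc i = w (Suc j)" using surj[OF i] by blast
      have "v $ j \<noteq> 0" using nz ind[OF vc i j] by (auto simp: u)
      then have "Suc j \<in> S" using v j by (simp add: coord_space_def)
      then show ?thesis using j by simp
    qed
    then show "u \<in> coord_space m (w ` S)"
      using mult_mat_vec_carrier[OF A vc] by (simp add: coord_space_def u)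
  next
    fix u assume u: "u \<in> coord_space m (w ` S)"
    define v where "v = vec m (\<lambda>j. u $ (w (Suc j) - 1) / c j)"
    have vc: "v \<in> carrier_vec m" by (simp add: v_def)
    have "Suc j \<in> S" if j: "j < m" "v $ j \<noteq> 0" for j
    proof -
      have "u $ (w (Suc j) - 1) \<noteq> 0" using j by (auto simp: v_def)
      moreover have "\<forall>i<m. u $ i \<noteq> 0 \<longrightarrow> Suc i \<in> w ` S" using u by (simp add: coord_space_def)
      ultimately have "Suc (w (Suc j) - 1) \<in> w ` S" using pos(1)[OF j(1)] by blast
      then have "w (Suc j) \<in> w ` S" unfolding pos(2)[OF j(1)] .
      then show ?thesis by (auto simp: inj)
    qed
    then have "v \<in> coord_space m S" using vc by (simp add: coord_space_def)
    moreover have "u = ?A *\<^sub>v v"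
    proof (rule eq_vecI)
      show "dim_vec u = dim_vec (?A *\<^sub>v v)" using u A by (auto simp: coord_space_def)
      fix i assume "i < dim_vec (?A *\<^sub>v v)"
      then have i: "i < m" using A by simp
      then obtain j where j: "j < m" "Suc i = w (Suc j)" using surj by blast
      have "w (Suc j) - 1 = i" using j(2) by simp
      then show "u $ i = (?A *\<^sub>v v) $ i" using ind[OF vc i j] c j by (simp add: v_def)
    qed
    ultimately show "u \<in> (\<lambda>v. ?A *\<^sub>v v) ` coord_space m S" by blast
  qed
qed

text \<open>
  Replaces the columns \<open>x\<close>, \<open>y\<close> with numbers \<open>a\<close>, \<open>b\<close> by \<open>z x + y\<close> and \<open>- x\<close>. At \<open>z = 0\<close> this
  swaps them up to sign, while for \<open>z \<noteq> 0\<close> the spans of the leading columns are those of the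
  matrix with columns \<open>x + y / z\<close>, \<open>y\<close>.
\<close>

definition turn :: "nat \<Rightarrow> nat \<Rightarrow> complex \<Rightarrow> complex mat \<Rightarrow> complex mat" where
  "turn a b z A = addcol (- 1) b a (addcol 1 a b (addcol (z - 1) b a A))"

lemma turn_carrier [simp]: "A \<in> carrier_mat m m \<Longrightarrow> turn a b z A \<in> carrier_mat m m"
  by (auto simp: turn_def mat_addcol_def)

lemma turn_index:
  assumes "A \<in> carrier_mat m m" "a < m" "b < m" "a \<noteq> b" "i < m" "j < m"
  shows "turn a b z A $$ (i, j) = (if j = a then z * A $$ (i, a) + A $$ (i, b)
    else if j = b then - A $$ (i, a) else A $$ (i, j))"
  using assms by (auto simp: turn_def algebra_simps)

lemma det_turn:
  assumes "A \<in> carrier_mat m m" "a < m" "b < m" "a \<noteq> b"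
  shows "det (turn a b z A) = det A"
proof -
  have carr: "addcol c k l B \<in> carrier_mat m m" if "B \<in> carrier_mat m m" for c k l and B :: "complex mat"
    using that by (auto simp: mat_addcol_def)
  show ?thesis
    unfolding turn_def using assms carr by (simp add: det_addcol[of _ m])
qed

lemma turn_SL:
  "A \<in> SL m \<Longrightarrow> a < m \<Longrightarrow> b < m \<Longrightarrow> a \<noteq> b \<Longrightarrow> turn a b z A \<in> SL m"
  by (auto simp: SL_def det_turn[of A m])

text \<open>\<open>turn\<close> consists of column operations, that is, of multiplications by fixed
  matrices on the right.\<close>

lemma mult_turn:
  assumes A: "A \<in> carrier_mat m m" and B: "B \<in> carrier_mat m m" and ab: "a < m" "b < m"
  shows "B * turn a b z A = turn a b z (B * A)"
proof -
  have *: "turn a b z X = X * (addrow_mat m (z - 1) a b * addrow_mat m 1 b a * addrow_mat m (- 1) a b)"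
    if "X \<in> carrier_mat m m" for X
  proof -
    have "turn a b z X = X * addrow_mat m (z - 1) a b * addrow_mat m 1 b a * addrow_mat m (- 1) a b"
      unfolding turn_def using that ab
      by (subst addcol_mat[of _ m m], auto)+
    then show ?thesis using that by (simp add: assoc_mult_mat[of _ m m _ m _ m] mult_carrier_mat[of _ m m _ m])
  qed
  show ?thesis
    using A B by (simp add: * assoc_mult_mat[of _ m m _ m _ m] mult_carrier_mat[of _ m m _ m])
qed

text \<open>On the columns \<open>a\<close>, \<open>b\<close> the matrix with rows
  \<open>(z, -1)\<close> and \<open>(1, 0)\<close> is the product of a lower unipotent, a diagonal
  and an upper unipotent matrix. For \<open>a < b\<close> the last two stabilize the base flag, so
  that in \<open>turn_act_base\<close> only the first remains.\<close>

lemma turn_nonzero: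
  assumes A: "A \<in> carrier_mat m m" and ab: "a < m" "b < m" "a \<noteq> b" and z: "z \<noteq> 0"
  shows "turn a b z A =
    A * addrow_mat m (1 / z) b a * torus_elem m a b z * addrow_mat m (- 1 / z) a b"
proof -
  let ?R = "addcol (- 1 / z) b a (multcol b (1 / z) (multcol a z (addcol (1 / z) a b A)))"
  have "A * addrow_mat m (1 / z) b a * torus_elem m a b z * addrow_mat m (- 1 / z) a b =
      A * addrow_mat m (1 / z) b a * multrow_mat m a z * multrow_mat m b (1 / z) *
        addrow_mat m (- 1 / z) a b"
    using A by (simp add: torus_elem_def assoc_mult_mat[of _ m m _ m _ m] mult_carrier_mat[of _ m m _ m])
  also have "\<dots> = ?R"
    using A ab by (simp add: addcol_mat[of _ m m] multcol_mat[of _ m m] mult_carrier_mat[of _ m m _ m])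
  also have "?R = turn a b z A"
  proof (rule eq_matI)
    fix i j assume "i < dim_row (turn a b z A)" "j < dim_col (turn a b z A)"
    then have ij: "i < m" "j < m" using turn_carrier[OF A, of a b z] by auto
    show "?R $$ (i, j) = turn a b z A $$ (i, j)"
      unfolding turn_index[OF A ab ij] using A ab ij z
      by (auto simp: field_simps)
  qed (use A in \<open>auto simp: turn_def\<close>)
  finally show ?thesis by simp
qed

lemma turn_monomial:
  assumes w: "w permutes {1..m}" and ab: "a < m" "b < m" "a \<noteq> b"
  shows "turn a b 0 (monomial_mat m w c) =
    monomial_mat m (w \<circ> transpose (Suc a) (Suc b)) (\<lambda>j. if j = a then c b else if j = b then - c a else c j)"
proof (rule eq_matI)
  let ?M = "monomial_mat m w c"
  let ?N = "monomial_mat m (w \<circ> transpose (Suc a) (Suc b)) (\<lambda>j. if j = a then c b else if j = b then - c a else c j)"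
  have M: "?M \<in> carrier_mat m m" by (simp add: monomial_mat_def)
  fix i j assume "i < dim_row ?N" "j < dim_col ?N"
  then have ij: "i < m" "j < m" by (auto simp: monomial_mat_def)
  show "turn a b 0 ?M $$ (i, j) = ?N $$ (i, j)"
    unfolding turn_index[OF M ab ij] using ab ij
    by (auto simp: monomial_mat_def transpose_def)
qed (auto simp: monomial_mat_def turn_def)

text \<open>Conjugation by a monomial matrix permutes the indices of a root subgroup. For
  \<open>a < b\<close> and \<open>w (Suc b) < w (Suc a)\<close> this turns a lower triangular factor
  into an upper triangular one, so a perturbation of the fixed point becomes a point of its Borel
  orbit.\<close>

lemma addrow_monomial:
  assumes w: "w permutes {1..m}" and c: "\<And>j. c j \<noteq> 0" and ab: "a < m" "b < m" "a \<noteq> b"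
  shows "monomial_mat m w c * addrow_mat m d b a =
    addrow_mat m (d * c b / c a) (w (Suc b) - 1) (w (Suc a) - 1) * monomial_mat m w c"
proof -
  let ?M = "monomial_mat m w c"
  have M: "?M \<in> carrier_mat m m" by (simp add: monomial_mat_def)
  have "w (Suc a) \<in> {1..m}" "w (Suc b) \<in> {1..m}"
    using ab by (auto simp only: permutes_in_image[OF w]) auto
  then obtain p q where p: "w (Suc a) = Suc p" "p < m" and q: "w (Suc b) = Suc q" "q < m"
    using Suc_le_D by fastforce
  have inj: "w x = w y \<longleftrightarrow> x = y" for x y using permutes_inj[OF w] by (simp add: inj_eq)
  have "?M * addrow_mat m d b a = addcol d a b ?M"
    by (rule addcol_mat[symmetric, OF M ab(2)])
  also have "\<dots> = addrow (d * c b / c a) q p ?M"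
  proof (rule eq_matI)
    fix i j assume "i < dim_row (addrow (d * c b / c a) q p ?M)" "j < dim_col (addrow (d * c b / c a) q p ?M)"
    then have ij: "i < m" "j < m" by (auto simp: monomial_mat_def)
    have "Suc p = w (Suc j) \<longleftrightarrow> j = a" using p(1) inj[of "Suc a" "Suc j"] by auto
    moreover have "Suc i = w (Suc b) \<longleftrightarrow> i = q" using q(1) by auto
    ultimately show "addcol d a b ?M $$ (i, j) = addrow (d * c b / c a) q p ?M $$ (i, j)"
      using ij ab p(2) q(2) c[of a] by (auto simp: monomial_mat_def)
  qed (auto simp: monomial_mat_def)
  also have "\<dots> = addrow_mat m (d * c b / c a) q p * ?M"
    by (rule addrow_mat[OF M p(2)])
  finally show ?thesis by (simp add: p q)
qed

text \<open>Starting from the identity matrix, \<open>turn\<close> at 0 realizes each further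
  transposition without changing the determinant.\<close>

lemma monomial_mat_SL_exists:
  assumes "w permutes {1..m}"
  shows "\<exists>c. (\<forall>j. c j \<noteq> 0) \<and> monomial_mat m w c \<in> SL m"
proof -
  have "finite {1..m}" by simp
  from this assms show ?thesis
  proof (induction rule: permutes_rev_induct)
    case id
    have "monomial_mat m id (\<lambda>_. 1) = 1\<^sub>m m" by (rule eq_matI) (auto simp: monomial_mat_def)
    moreover have "1\<^sub>m m \<in> SL m" by (simp add: SL_def)
    ultimately show ?case by (intro exI[of _ "\<lambda>_. 1"]) (simp only: one_neq_zero simp_thms)
  next
    case (swap a b p)
    then obtain c where c: "\<forall>j. c j \<noteq> 0" "monomial_mat m p c \<in> SL m" by blast
    have ab: "a - 1 < m" "b - 1 < m" "a - 1 \<noteq> b - 1" and Suc: "Suc (a - 1) = a" "Suc (b - 1) = b"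
      using swap.hyps by auto
    have "turn (a - 1) (b - 1) 0 (monomial_mat m p c) \<in> SL m"
      by (rule turn_SL[OF c(2) ab])
    then show ?case
      unfolding turn_monomial[OF \<open>p permutes {1..m}\<close> ab] Suc using c(1)
      by (intro exI[of _ "\<lambda>j. if j = a - 1 then c (b - 1) else if j = b - 1 then - c (a - 1) else c j"] conjI)
        (simp, simp only:)
  qed
qed

section \<open>Limits in Zariski closed sets\<close>

lemma isCont_mat_polynomial:
  assumes "p \<in> mat_polynomials m"
    and "\<And>i j. i < m \<Longrightarrow> j < m \<Longrightarrow> isCont (\<lambda>z::complex. M z $$ (i, j)) z0"
  shows "isCont (\<lambda>z. p (M z)) z0"
  using assms by (induction rule: mat_polynomials.induct) (auto intro!: continuous_intros)

text \<open>Polynomials are continuous, so equations valid off \<open>z0\<close> persist at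
  \<open>z0\<close>; ordinary complex limits therefore stay within Zariski closed sets.\<close>

lemma zariski_closed_SL_limit:
  assumes Z: "zariski_closed_SL m Z"
    and cont: "\<And>i j. i < m \<Longrightarrow> j < m \<Longrightarrow> isCont (\<lambda>z::complex. M z $$ (i, j)) z0"
    and in_Z: "\<And>z. z \<noteq> z0 \<Longrightarrow> M z \<in> Z" and SL: "M z0 \<in> SL m"
  shows "M z0 \<in> Z"
proof -
  obtain S where S: "S \<subseteq> mat_polynomials m" and Z_eq: "Z = {A \<in> SL m. \<forall>p\<in>S. p A = 0}"
    using Z by (auto simp: zariski_closed_SL_def)
  have "p (M z0) = 0" if p: "p \<in> S" for p
  proof -
    have "((\<lambda>z. p (M z)) \<longlongrightarrow> p (M z0)) (at z0)"
      using isCont_mat_polynomial[where M = M and m = m and ?z0.0 = z0, of p] p S cont by (auto simp: isCont_def)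
    moreover have "((\<lambda>z. p (M z)) \<longlongrightarrow> 0) (at z0)"
    proof (rule tendsto_eventually)
      show "\<forall>\<^sub>F z in at z0. p (M z) = 0"
        unfolding eventually_at_filter using in_Z p by (auto simp: Z_eq)
    qed
    ultimately show ?thesis by (rule tendsto_unique[rotated]) simp
  qed
  then show ?thesis using SL by (simp add: Z_eq)
qed

section \<open>Matrices acting on coordinate flags\<close>

lemma flag_subset:
  assumes "w permutes {1..2 * n}" "k \<in> {1..n}"
  shows "w ` {1..2 * k - 1} \<subseteq> {1..2 * n :: nat}"
proof -
  have "w ` {1..2 * k - 1} \<subseteq> w ` {1..2 * n}" using assms(2) by (intro image_mono) auto
  then show ?thesis unfolding permutes_image[OF assms(1)] .
qed

lemma perm_flag_eq_coord_space:
  assumes "w permutes {1..2 * n}" "k \<in> {1..n}"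
  shows "perm_flag n w k = coord_space (2 * n) (w ` {1..2 * k - 1})"
  unfolding perm_flag_def using assms(2) flag_subset[OF assms] by (rule coord_subspaces_eq)

lemma monomial_act_base:
  assumes "w permutes {1..2 * n}" "\<And>j. c j \<noteq> 0"
  shows "act n (monomial_mat (2 * n) w c) (perm_flag n id) = perm_flag n w"
  unfolding perm_flag_def
proof (rule act_coord_subspacesI)
  fix k assume k: "k \<in> {1..n}"
  show "id ` {1..2 * k - 1} \<subseteq> {1..2 * n}" "w ` {1..2 * k - 1} \<subseteq> {1..2 * n}"
    using flag_subset[OF permutes_id k] flag_subset[OF assms(1) k] .
  then show "(\<lambda>v. monomial_mat (2 * n) w c *\<^sub>v v) ` coord_space (2 * n) (id ` {1..2 * k - 1}) =
      coord_space (2 * n) (w ` {1..2 * k - 1})"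
    using monomial_mat_coord_space[OF assms, of "id ` {1..2 * k - 1}"] by (simp only: image_id id_apply)
qed

lemma perm_flag_carrier:
  assumes "w permutes {1..2 * n}" "k \<in> {1..n}"
  shows "perm_flag n w k \<subseteq> carrier_vec (2 * n)"
  using perm_flag_eq_coord_space[OF assms] by (auto simp: coord_space_def)

lemma turn_act_base:
  assumes A: "A \<in> carrier_mat (2 * n) (2 * n)" and ab: "a < b" "b < 2 * n" and z: "z \<noteq> 0"
  shows "act n (turn a b z A) (perm_flag n id) =
    act n (A * addrow_mat (2 * n) (1 / z) b a) (perm_flag n id)"
proof -
  let ?m = "2 * n" and ?F = "perm_flag n id"
  let ?D = "torus_elem ?m a b z" and ?E = "addrow_mat ?m (- 1 / z) a b"
  let ?B = "A * addrow_mat ?m (1 / z) b a"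
  have D: "?D \<in> diag_torus ?m" using ab z by (intro torus_elem_in_diag_torus) auto
  then have Dc: "?D \<in> carrier_mat ?m ?m" by (auto simp: diag_torus_def SL_def)
  have F: "?F k \<subseteq> carrier_vec ?m" if "k \<in> {1..n}" for k
    using perm_flag_carrier[OF permutes_id that] .
  \<comment> \<open>As \<open>a < b\<close>, a set \<open>{1..2 * k - 1}\<close> that contains
    \<open>Suc b\<close> also contains \<open>Suc a\<close>.\<close>
  have "act n ?E ?F = ?F"
    unfolding perm_flag_def using flag_subset[OF permutes_id] ab
    by (intro act_coord_subspacesI addrow_mat_coord_space) auto
  moreover have "act n ?D ?F = ?F"
    unfolding perm_flag_def
    by (rule diag_torus_act_coord_subspaces[OF D]) (rule flag_subset[OF permutes_id])
  moreover have "turn a b z A = ?B * (?D * ?E)"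
    unfolding turn_nonzero[OF A less_trans[OF ab] ab(2) less_imp_neq[OF ab(1)] z]
    by (rule assoc_mult_mat[OF mult_carrier_mat[OF A addrow_mat_carrier] Dc addrow_mat_carrier])
  moreover have "act n (?B * (?D * ?E)) ?F = act n ?B (act n (?D * ?E) ?F)"
    by (rule act_mult[OF mult_carrier_mat[OF A addrow_mat_carrier]
          mult_carrier_mat[OF Dc addrow_mat_carrier] F])
  moreover have "act n (?D * ?E) ?F = act n ?D (act n ?E ?F)"
    by (rule act_mult[OF Dc addrow_mat_carrier F])
  ultimately show ?thesis by (simp only:)
qed

lemma upper_triangular_mult:
  assumes "A \<in> carrier_mat m m" "B \<in> carrier_mat m m"
    and "upper_triangular A" "upper_triangular B"
  shows "upper_triangular (A * B :: 'a :: semiring_0 mat)"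
proof (rule upper_triangularI)
  fix i j assume "j < i" "i < dim_row (A * B)"
  then have ij: "j < i" "i < m" using assms(1) by auto
  have "A $$ (i, k) * B $$ (k, j) = 0" if "k < m" for k
    using assms that ij upper_triangularD[of A k i] upper_triangularD[of B j k] by (cases "k < i") auto
  then show "(A * B) $$ (i, j) = 0"
    using assms(1,2) ij by (auto simp: scalar_prod_def intro!: sum.neutral)
qed

lemma borel_mult:
  assumes "A \<in> borel m" "B \<in> borel m"
  shows "A * B \<in> borel m"
  using assms upper_triangular_mult[of A m B] by (auto simp: borel_def SL_def det_mult[of _ m])

text \<open>
  For \<open>a < b\<close> and \<open>w b < w a\<close> the \<open>T\<close>-stable curve joining the fixed points of \<open>w\<close> and of
  \<open>w \<circ> (a b)\<close> lies in the Borel orbit of the former except for the latter.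
\<close>

lemma borel_orbit_closure_step:
  assumes Y: "zariski_closed_flags n Y"
    and orbit: "(\<lambda>A. act n A (perm_flag n w)) ` borel (2 * n) \<subseteq> Y"
    and w: "w permutes {1..2 * n}"
    and ab: "a \<in> {1..2 * n}" "b \<in> {1..2 * n}" "a < b" and desc: "w b < w a"
  shows "(\<lambda>A. act n A (perm_flag n (w \<circ> transpose a b))) ` borel (2 * n) \<subseteq> Y"
proof
  let ?m = "2 * n" and ?F = "perm_flag n id" and ?v = "w \<circ> transpose a b"
  fix y assume "y \<in> (\<lambda>A. act n A (perm_flag n ?v)) ` borel ?m"
  then obtain B where B: "B \<in> borel ?m" and y: "y = act n B (perm_flag n ?v)" by blast
  have Bc: "B \<in> carrier_mat ?m ?m" and B_SL: "B \<in> SL ?m" using B by (auto simp: borel_def SL_def)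
  define p q where "p = a - 1" and "q = b - 1"
  have pq: "p < q" "q < ?m" "p < ?m" "p \<noteq> q" and Suc: "Suc p = a" "Suc q = b"
    using ab by (auto simp: p_def q_def)
  obtain c where c: "\<And>j. c j \<noteq> 0" and M_SL: "monomial_mat ?m w c \<in> SL ?m"
    using monomial_mat_SL_exists[OF w] by blast
  let ?M = "monomial_mat ?m w c"
  have M: "?M \<in> carrier_mat ?m ?m" by (simp add: monomial_mat_def)
  have F: "?F k \<subseteq> carrier_vec ?m" if "k \<in> {1..n}" for k
    using perm_flag_carrier[OF permutes_id that] .
  have BM: "B * ?M \<in> carrier_mat ?m ?m" "B * ?M \<in> SL ?m"
    using Bc M B_SL M_SL by (auto simp: SL_def det_mult[of _ ?m])
  let ?Z = "{A \<in> SL ?m. act n A ?F \<in> Y}"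
  \<comment> \<open>Translating the curve by \<open>B\<close> reaches every point of the orbit of
    \<open>?v\<close>, not just its fixed point. Closedness of \<open>Y\<close> is available only
    through the preimage \<open>?Z\<close>.\<close>
  have "turn p q 0 (B * ?M) \<in> ?Z"
  proof (rule zariski_closed_SL_limit[where M = "\<lambda>z. turn p q z (B * ?M)"])
    show "zariski_closed_SL ?m ?Z" using Y by (simp add: zariski_closed_flags_def)
    show "turn p q 0 (B * ?M) \<in> SL ?m" by (rule turn_SL[OF BM(2) pq(3,2,4)])
    show "isCont (\<lambda>z. turn p q z (B * ?M) $$ (i, j)) 0" if "i < ?m" "j < ?m" for i j
      unfolding turn_index[OF BM(1) pq(3,2,4) that] using pq by (cases "j = p"; cases "j = q") (auto intro!: continuous_intros)
    fix z :: complex assume z: "z \<noteq> 0"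
    have wab: "w a \<in> {1..?m}" "w b \<in> {1..?m}" using ab by (simp_all only: permutes_in_image[OF w])
    define d where "d = 1 / z * c q / c p"
    let ?X = "addrow_mat ?m d (w b - 1) (w a - 1)"
    \<comment> \<open>Here the descent enters: it puts the off-diagonal entry of \<open>?X\<close>
      above the diagonal, so that \<open>?X\<close> can be absorbed into the Borel group.\<close>
    have lt: "w b - 1 < w a - 1" "w a - 1 < ?m" using wab desc by auto
    then have "upper_triangular ?X" by (intro upper_triangularI) auto
    then have X: "?X \<in> borel ?m"
      using lt det_addrow_mat[of "w b - 1" "w a - 1" ?m d] by (auto simp: borel_def SL_def)
    let ?E = "addrow_mat ?m (1 / z) q p"
    have "act n (turn p q z (B * ?M)) ?F = act n (B * ?M * ?E) ?F"
      by (rule turn_act_base[OF BM(1) pq(1,2) z])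
    moreover have "B * ?M * ?E = B * (?M * ?E)"
      by (rule assoc_mult_mat[OF Bc M addrow_mat_carrier])
    moreover have "?M * ?E = ?X * ?M"
      unfolding addrow_monomial[OF w c pq(3,2,4)] d_def Suc ..
    moreover have "B * (?X * ?M) = B * ?X * ?M"
      by (rule assoc_mult_mat[OF Bc addrow_mat_carrier M, symmetric])
    moreover have "act n (B * ?X * ?M) ?F = act n (B * ?X) (act n ?M ?F)"
      by (rule act_mult[OF mult_carrier_mat[OF Bc addrow_mat_carrier] M F])
    moreover have "act n ?M ?F = perm_flag n w" by (rule monomial_act_base[OF w c])
    moreover have "act n (B * ?X) (perm_flag n w) \<in> Y"
      using orbit borel_mult[OF B X] by blast
    ultimately have "act n (turn p q z (B * ?M)) ?F \<in> Y" by (simp only:)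
    then show "turn p q z (B * ?M) \<in> ?Z"
      by (intro CollectI conjI turn_SL[OF BM(2) pq(3,2,4)])
  qed
  then have "act n (turn p q 0 (B * ?M)) ?F \<in> Y" by (elim CollectE conjE)
  moreover have "B * turn p q 0 ?M = turn p q 0 (B * ?M)"
    by (rule mult_turn[OF M Bc pq(3,2)])
  moreover have "act n (B * turn p q 0 ?M) ?F = act n B (act n (turn p q 0 ?M) ?F)"
    by (rule act_mult[OF Bc turn_carrier[OF M] F])
  moreover have "act n (turn p q 0 ?M) ?F = perm_flag n ?v"
    unfolding turn_monomial[OF w pq(3,2,4)] Suc
    using ab c by (intro monomial_act_base permutes_compose[OF permutes_swap_id w]) auto
  ultimately show "y \<in> Y" by (simp only: y)
qed

section \<open>The interval below \<open>tau_perm\<close>\<close>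

lemma tau_perm_permutes: "tau_perm N permutes {1..2 * N}"
proof -
  have sub: "tau_perm N ` {1..2 * N} \<subseteq> {1..2 * N}" by (auto simp: tau_perm_def)
  have inj: "inj_on (tau_perm N) {1..2 * N}"
    by (rule inj_onI) (auto simp: tau_perm_def split: if_splits elim!: oddE evenE)
  have "bij_betw (tau_perm N) {1..2 * N} {1..2 * N}"
    using endo_inj_surj[OF _ sub inj] inj by (simp add: bij_betw_def)
  then show ?thesis by (rule bij_imp_permutes) (auto simp: tau_perm_def)
qed

lemma bar_tau_perm: "bar n (tau_perm (n + 1)) = sigma_perm n"
proof
  fix i
  show "bar n (tau_perm (n + 1)) i = sigma_perm n i"
    by (cases "even i") (auto simp: bar_def tau_perm_def sigma_perm_def elim!: evenE oddE)
qed

lemma bar_permutes: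
  assumes w: "w permutes {1..2 * (n + 1)}" and ends: "w 1 = 1" "w (2 * (n + 1)) = 2 * (n + 1)"
  shows "bar n w permutes {1..2 * n}"
proof -
  have inj: "w x = w y \<longleftrightarrow> x = y" for x y using permutes_inj[OF w] by (simp add: inj_eq)
  have range: "2 \<le> w (i + 1)" "w (i + 1) \<le> 2 * n + 1" if i: "i \<in> {1..2 * n}" for i
  proof -
    have "w (i + 1) \<in> {1..2 * (n + 1)}" using i by (subst permutes_in_image[OF w]) auto
    moreover have "w (i + 1) \<noteq> 1" "w (i + 1) \<noteq> 2 * (n + 1)"
      using inj[of "i + 1" 1] inj[of "i + 1" "2 * (n + 1)"] ends i by auto
    ultimately show "2 \<le> w (i + 1)" "w (i + 1) \<le> 2 * n + 1" by auto
  qed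
  have sub: "bar n w ` {1..2 * n} \<subseteq> {1..2 * n}"
    using range by (fastforce simp: bar_def)
  have inj_bar: "inj_on (bar n w) {1..2 * n}"
  proof (rule inj_onI)
    fix i j assume ij: "i \<in> {1..2 * n}" "j \<in> {1..2 * n}" and "bar n w i = bar n w j"
    then have "w (i + 1) = w (j + 1)" using range(1)[OF ij(1)] range(1)[OF ij(2)] by (simp add: bar_def)
    then show "i = j" by (simp add: inj)
  qed
  have "bij_betw (bar n w) {1..2 * n} {1..2 * n}"
    using endo_inj_surj[OF _ sub inj_bar] inj_bar by (simp add: bij_betw_def)
  then show ?thesis by (rule bij_imp_permutes) (auto simp: bar_def)
qed

lemma bar_comp_transpose:
  assumes "a \<in> {2..2 * n + 1}" "b \<in> {2..2 * n + 1}"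
  shows "bar n (w \<circ> transpose a b) = bar n w \<circ> transpose (a - 1) (b - 1)"
proof
  fix i
  have "transpose a b (i + 1) = transpose (a - 1) (b - 1) i + 1"
    using assms by (auto simp: transpose_def)
  moreover have "transpose (a - 1) (b - 1) i \<in> {1..2 * n} \<longleftrightarrow> i \<in> {1..2 * n}"
    using assms by (auto simp: transpose_def)
  moreover have "transpose (a - 1) (b - 1) i = i" if "i \<notin> {1..2 * n}"
    using assms that by (auto simp: transpose_def)
  ultimately show "bar n (w \<circ> transpose a b) i = (bar n w \<circ> transpose (a - 1) (b - 1)) i"
    by (simp only: bar_def comp_apply) metis
qed

text \<open>Induction down a Bruhat chain. The end values are part of the statement because they
  make \<open>bar\<close> a permutation and force every exchange of the chain to take place at inner
  positions, where it descends to \<open>{1..2 * n}\<close>.\<close>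

lemma bruhat_le_tau_perm:
  assumes "bruhat_le (2 * (n + 1)) u (tau_perm (n + 1))"
  shows "u permutes {1..2 * (n + 1)} \<and> u 1 = 1 \<and> u (2 * (n + 1)) = 2 * (n + 1) \<and>
    (\<forall>Y. zariski_closed_flags n Y \<longrightarrow>
      (\<lambda>A. act n A (perm_flag n (sigma_perm n))) ` borel (2 * n) \<subseteq> Y \<longrightarrow>
      (\<lambda>A. act n A (perm_flag n (bar n u))) ` borel (2 * n) \<subseteq> Y)"
  using assms unfolding bruhat_le_def
proof (induction rule: converse_rtranclp_induct)
  case base
  have "tau_perm (n + 1) 1 = 1" "tau_perm (n + 1) (2 * (n + 1)) = 2 * (n + 1)"
    by (auto simp: tau_perm_def)
  then show ?case by (simp only: tau_perm_permutes bar_tau_perm) blast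
next
  case (step u w)
  let ?m = "2 * (n + 1)"
  have ends: "w 1 = 1" "w ?m = ?m"
    and orbit: "\<And>Y. zariski_closed_flags n Y \<Longrightarrow>
      (\<lambda>A. act n A (perm_flag n (sigma_perm n))) ` borel (2 * n) \<subseteq> Y \<Longrightarrow>
      (\<lambda>A. act n A (perm_flag n (bar n w))) ` borel (2 * n) \<subseteq> Y"
    using step.IH by blast+
  obtain a b where u: "u permutes {1..?m}" and w: "w permutes {1..?m}"
    and ab: "a \<in> {1..?m}" "b \<in> {1..?m}" "a < b" and desc: "w b < w a"
    and uw: "u = w \<circ> transpose a b"
    using step.hyps(1) by (elim bruhat_stepE)
  have "w a \<in> {1..?m}" "w b \<in> {1..?m}" using ab by (simp_all only: permutes_in_image[OF w])
  \<comment> \<open>The larger of the two values stands at \<open>a\<close> and the smaller at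
    \<open>b\<close>, so \<open>a\<close> is not the position of the least value and
    \<open>b\<close> is not that of the greatest.\<close>
  then have "a \<noteq> 1" "b \<noteq> ?m" using desc ends by auto
  then have ab2: "a \<in> {2..2 * n + 1}" "b \<in> {2..2 * n + 1}" using ab by auto
  have "u 1 = 1" "u ?m = ?m" using ab2 ends by (auto simp: uw transpose_def)
  moreover have "(\<lambda>A. act n A (perm_flag n (bar n u))) ` borel (2 * n) \<subseteq> Y"
    if Y: "zariski_closed_flags n Y"
      "(\<lambda>A. act n A (perm_flag n (sigma_perm n))) ` borel (2 * n) \<subseteq> Y" for Y
    unfolding uw bar_comp_transpose[OF ab2]
  proof (rule borel_orbit_closure_step[OF Y(1) orbit[OF Y] bar_permutes[OF w ends]])
    show "a - 1 \<in> {1..2 * n}" "b - 1 \<in> {1..2 * n}" "a - 1 < b - 1" using ab2 ab(3) by auto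
    have "w b \<ge> 1" using \<open>w b \<in> {1..?m}\<close> by simp
    then show "bar n w (b - 1) < bar n w (a - 1)" using ab2 desc by (auto simp: bar_def)
  qed
  ultimately show ?case using u by blast
qed

lemma one_in_diag_torus: "1\<^sub>m m \<in> diag_torus m"
  by (simp add: diag_torus_def SL_def diagonal_mat_def)

lemma alpha_fixed_point:
  assumes \<sigma>: "bruhat_le (2 * (n + 1)) \<sigma> (tau_perm (n + 1))"
  shows "alpha n \<sigma> \<in> torus_fixed (2 * n) n (schubert_variety n (sigma_perm n))"
proof -
  have perm: "bar n \<sigma> permutes {1..2 * n}"
    using bruhat_le_tau_perm[OF \<sigma>] by (intro bar_permutes) auto
  have fixed: "act n t (alpha n \<sigma>) = alpha n \<sigma>" if "t \<in> diag_torus (2 * n)" for t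
    unfolding alpha_def perm_flag_def
    by (rule diag_torus_act_coord_subspaces[OF that]) (rule flag_subset[OF perm])
  have one: "1\<^sub>m (2 * n) \<in> borel (2 * n)" by (auto simp: borel_def SL_def)
  have "alpha n \<sigma> \<in> schubert_variety n (sigma_perm n)"
    unfolding schubert_variety_def
  proof (rule InterI, elim CollectE conjE)
    fix Y assume Y: "zariski_closed_flags n Y"
      "(\<lambda>A. act n A (perm_flag n (sigma_perm n))) ` borel (2 * n) \<subseteq> Y"
    then have "(\<lambda>A. act n A (alpha n \<sigma>)) ` borel (2 * n) \<subseteq> Y"
      using bruhat_le_tau_perm[OF \<sigma>] unfolding alpha_def by blast
    then have "act n (1\<^sub>m (2 * n)) (alpha n \<sigma>) \<in> Y" using one by blast
    then show "alpha n \<sigma> \<in> Y" by (simp only: fixed[OF one_in_diag_torus])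
  qed
  then show ?thesis using fixed by (simp add: torus_fixed_def)
qed

section \<open>Commutativity\<close>

definition fixed_point_indices :: "nat \<Rightarrow> (nat \<Rightarrow> nat set) \<Rightarrow> bool" where
  "fixed_point_indices n I \<longleftrightarrow> (\<forall>k\<in>{1..n}. I k \<subseteq> {1..n + 1} \<and> card (I k) = k) \<and>
     (\<forall>k\<in>{1..<n}. I k - {k + 1} \<subseteq> I (k + 1))"

lemma fixed_point_indices_index_sets:
  assumes V: "V \<in> torus_fixed (n + 1) n (degenerate_flags n)"
  shows "fixed_point_indices n (index_sets (n + 1) n V)"
  unfolding fixed_point_indices_def
proof (intro conjI ballI)
  have Gr: "V k \<in> Gr k (n + 1)" if "k \<in> {1..n}" for k
    using V that by (auto simp: torus_fixed_def degenerate_flags_def)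
  have fixed: "(\<lambda>v. t *\<^sub>v v) ` V k = V k" if "t \<in> diag_torus (n + 1)" "k \<in> {1..n}" for t k
  proof -
    have "act n t V k = V k" using V that(1) by (simp add: torus_fixed_def)
    then show ?thesis using that(2) by (simp add: act_def)
  qed
  have ind: "index_sets (n + 1) n V k = {i \<in> {1..n + 1}. basis_vec (n + 1) i \<in> V k}"
    if "k \<in> {1..n}" for k
    using that by (simp add: index_sets_def)
  fix k assume k: "k \<in> {1..n}"
  show "index_sets (n + 1) n V k \<subseteq> {1..n + 1}" unfolding ind[OF k] by blast
  show "card (index_sets (n + 1) n V k) = k"
    unfolding ind[OF k] by (rule fixed_Gr_card[OF Gr[OF k] fixed[OF _ k]])
next
  fix k assume k: "k \<in> {1..<n}"
  have pr: "pr (n + 1) (k + 1) ` V k \<subseteq> V (k + 1)"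
    using V k by (auto simp: torus_fixed_def degenerate_flags_def)
  have "pr (n + 1) (k + 1) (basis_vec (n + 1) i) = basis_vec (n + 1) i"
    if "i \<in> {1..n + 1}" "i \<noteq> k + 1" for i
    using that by (intro eq_vecI) (auto simp: pr_def basis_vec_index basis_vec_def)
  then have "basis_vec (n + 1) i \<in> V (k + 1)"
    if "i \<in> {1..n + 1}" "i \<noteq> k + 1" "basis_vec (n + 1) i \<in> V k" for i
    using pr that by (metis image_subset_iff)
  then show "index_sets (n + 1) n V k - {k + 1} \<subseteq> index_sets (n + 1) n V (k + 1)"
    using k by (auto simp: index_sets_def)
qed

section \<open>Marked columns and index sets\<close>

lemma inj_on_col: "inj_on (col n l) {1..n + 1}"
  by (rule inj_onI) (auto simp: col_def split: if_splits)

lemma in_col_image_iff: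
  assumes "S \<subseteq> {1..n + 1}" "l \<le> n + 1"
  shows "x \<in> col n l ` S \<longleftrightarrow>
    l < x \<and> x \<le> n + 1 \<and> x \<in> S \<or> n + 1 < x \<and> x - (n + 1) \<le> l \<and> x - (n + 1) \<in> S"
proof
  assume "x \<in> col n l ` S"
  then obtain j where "j \<in> S" "x = col n l j" by blast
  then show "l < x \<and> x \<le> n + 1 \<and> x \<in> S \<or> n + 1 < x \<and> x - (n + 1) \<le> l \<and> x - (n + 1) \<in> S"
    using assms by (auto simp: col_def)
next
  assume "l < x \<and> x \<le> n + 1 \<and> x \<in> S \<or> n + 1 < x \<and> x - (n + 1) \<le> l \<and> x - (n + 1) \<in> S"
  then consider "l < x" "x \<in> S" | "n + 1 < x" "x - (n + 1) \<le> l" "x - (n + 1) \<in> S" by blast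
  then show "x \<in> col n l ` S"
  proof cases
    case 1
    then show ?thesis by (intro image_eqI[of _ _ x]) (auto simp: col_def)
  next
    case 2
    then show ?thesis by (intro image_eqI[of _ _ "x - (n + 1)"]) (auto simp: col_def)
  qed
qed

lemma in_kappa_image_iff:
  assumes "S \<subseteq> {1..n + 1}"
  shows "x \<in> kappa n ` S \<longleftrightarrow> x = n + 1 \<and> 1 \<in> S \<or> 1 \<le> x \<and> x \<le> n \<and> x + 1 \<in> S"
proof
  assume "x \<in> kappa n ` S"
  then obtain j where j: "j \<in> S" "x = kappa n j" by blast
  then have "j \<in> {1..n + 1}" using assms by blast
  with j show "x = n + 1 \<and> 1 \<in> S \<or> 1 \<le> x \<and> x \<le> n \<and> x + 1 \<in> S"
    by (cases "j = 1") (auto simp: kappa_def)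
next
  assume "x = n + 1 \<and> 1 \<in> S \<or> 1 \<le> x \<and> x \<le> n \<and> x + 1 \<in> S"
  then show "x \<in> kappa n ` S"
  proof (elim disjE conjE)
    assume "x = n + 1" "1 \<in> S"
    then show ?thesis by (intro image_eqI[of _ _ 1]) (auto simp: kappa_def)
  next
    assume "1 \<le> x" "x + 1 \<in> S"
    then show ?thesis by (intro image_eqI[of _ _ "x + 1"]) (auto simp: kappa_def)
  qed
qed

context
  fixes n :: nat and I :: "nat \<Rightarrow> nat set"
  assumes I: "fixed_point_indices n I"
begin

lemma extend_ends_subset: "l \<le> n + 1 \<Longrightarrow> extend_ends n I l \<subseteq> {1..n + 1}"
  using I by (auto simp: extend_ends_def fixed_point_indices_def)

lemma extend_ends_card: "l \<le> n + 1 \<Longrightarrow> card (extend_ends n I l) = l"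
  using I by (auto simp: extend_ends_def fixed_point_indices_def)

lemma extend_ends_mono:
  assumes "l \<le> n"
  shows "extend_ends n I l - {Suc l} \<subseteq> extend_ends n I (Suc l)"
proof -
  consider "l = 0" | "l = n" | "l \<in> {1..<n}" using assms by force
  then show ?thesis
  proof cases
    case 1
    then show ?thesis by (simp add: extend_ends_def)
  next
    case 2
    then have "extend_ends n I (Suc l) = {1..n + 1}" by (simp add: extend_ends_def)
    moreover have "extend_ends n I l \<subseteq> {1..n + 1}" using assms by (intro extend_ends_subset) simp
    ultimately show ?thesis by (simp only:) blast
  next
    case 3
    then have "I l - {l + 1} \<subseteq> I (l + 1)" using I unfolding fixed_point_indices_def by blast
    then show ?thesis using 3 by (simp add: extend_ends_def)
  qed
qed

text \<open>From \<open>l\<close> to \<open>L = Suc l\<close> only the column of the index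
  \<open>L\<close> changes, from \<open>L\<close> to \<open>L + n + 1\<close>. Column
  \<open>L\<close> is already present if \<open>L\<close> is in \<open>A\<close>; otherwise row
  \<open>L\<close> marks it. Column \<open>L + n + 1\<close> is needed if \<open>L\<close> is in
  \<open>B\<close>: it comes from the new elements of \<open>B\<close> or, when \<open>L\<close> was
  already in \<open>A\<close>, from the second case of \<open>row_cols\<close>.\<close>

lemma Union_row_cols:
  "l \<le> n + 1 \<Longrightarrow> (\<Union>k\<in>{1..l}. row_cols n I k) = {1..l} \<union> col n l ` extend_ends n I l"
proof (induction l)
  case 0
  show ?case by (simp add: extend_ends_def)
next
  case (Suc l)
  define A B L where "A = extend_ends n I l" and "B = extend_ends n I (Suc l)" and "L = Suc l"
  have AB: "A - {L} \<subseteq> B" using extend_ends_mono[of l] Suc.prems by (simp add: A_def B_def L_def)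
  have col_eq: "col n l j = col n L j" if "j \<noteq> L" for j using that by (auto simp: col_def L_def)
  have colL: "col n l L = L" "col n L L = L + n + 1" by (auto simp: col_def L_def)
  have colA: "col n l ` A = col n L ` (A - {L}) \<union> (if L \<in> A then {L} else {})"
  proof -
    have "A = (A - {L}) \<union> (if L \<in> A then {L} else {})" by auto
    then have "col n l ` A = col n l ` (A - {L}) \<union> col n l ` (if L \<in> A then {L} else {})"
      by (metis image_Un)
    also have "col n l ` (A - {L}) = col n L ` (A - {L})" by (rule image_cong) (auto simp: col_eq)
    finally show ?thesis by (simp add: colL split: if_splits)
  qed
  have row: "row_cols n I L = (if L \<notin> A then {L} \<union> col n L ` (B - A)
      else if L \<in> B then {L + n + 1} \<union> col n L ` (B - A) else col n L ` (B - A))"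
    by (simp add: row_cols_def A_def B_def L_def Let_def)
  have "(\<Union>k\<in>{1..L}. row_cols n I k) = (\<Union>k\<in>{1..l}. row_cols n I k) \<union> row_cols n I L"
    by (auto simp: L_def atLeastAtMostSuc_conv)
  also have "(\<Union>k\<in>{1..l}. row_cols n I k) = {1..l} \<union> col n l ` A"
    using Suc by (simp add: A_def)
  also have "{1..l} \<union> col n l ` A \<union> row_cols n I L = {1..L} \<union> col n L ` B"
  proof -
    have "col n L ` B = col n L ` (A - {L}) \<union> col n L ` (B - A) \<union> (if L \<in> A \<and> L \<in> B then {L + n + 1} else {})"
    proof -
      have "B = (A - {L}) \<union> (B - A) \<union> (if L \<in> A \<and> L \<in> B then {L} else {})" using AB by auto
      then have "col n L ` B = col n L ` (A - {L}) \<union> col n L ` (B - A) \<union>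
          col n L ` (if L \<in> A \<and> L \<in> B then {L} else {})"
        by (metis image_Un)
      then show ?thesis by (simp add: colL split: if_splits)
    qed
    moreover have "{1..L} = insert L {1..l}" by (auto simp: L_def)
    ultimately show ?thesis unfolding colA row by (simp add: Un_ac)
  qed
  finally show ?case by (simp add: L_def B_def)
qed

text \<open>If \<open>l\<close> is lost from one set to the next, two new elements must appear
  instead of one. In the other cases a column \<open>l\<close> or \<open>l + n + 1\<close> is added
  to one column: \<open>col n l\<close> never takes the value \<open>l\<close>, and it takes
  \<open>l + n + 1\<close> only at \<open>l\<close>, which is then no new element.\<close>

lemma card_row_cols:
  assumes l: "l \<in> {1..n + 1}"
  shows "card (row_cols n I l) = 2"
proof -
  define A B where "A = extend_ends n I (l - 1)" and "B = extend_ends n I l"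
  have "l - 1 \<le> n" "Suc (l - 1) = l" using l by auto
  then have AB: "A - {l} \<subseteq> B" using extend_ends_mono[of "l - 1"] by (simp add: A_def B_def)
  have cards: "card A = l - 1" "card B = l"
    using extend_ends_card[of "l - 1"] extend_ends_card[of l] l by (auto simp: A_def B_def)
  have subs: "A \<subseteq> {1..n + 1}" "B \<subseteq> {1..n + 1}"
    using extend_ends_subset \<open>l - 1 \<le> n\<close> l by (simp_all add: A_def B_def del: One_nat_def)
  then have fin: "finite A" "finite B" using finite_subset by blast+
  have card_col: "card (col n l ` (B - A)) = card (B - A)"
    by (rule card_image, rule inj_on_subset[OF inj_on_col]) (use subs in blast)
  have row: "row_cols n I l = (if l \<notin> A then {l} \<union> col n l ` (B - A)
      else if l \<in> B then {l + n + 1} \<union> col n l ` (B - A) else col n l ` (B - A))"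
    by (simp add: row_cols_def A_def B_def Let_def)
  show ?thesis
  proof (cases "l \<in> A \<and> l \<notin> B")
    case True
    then have "B - A = B - (A - {l})" by auto
    then have "card (B - A) = card B - card (A - {l})"
      using card_Diff_subset[OF _ AB] fin by simp
    \<comment> \<open>For \<open>l = 1\<close> truncated subtraction would make the following count
      1 instead of 2.\<close>
    moreover have "l - 1 \<noteq> 0" using True cards(1) fin by auto
    ultimately have "card (B - A) = 2" using True cards fin by simp
    then show ?thesis using True card_col by (simp add: row)
  next
    case False
    then have "A \<subseteq> B" using AB by auto
    then have "card (B - A) = 1" using card_Diff_subset[OF fin(1), of B] cards l by simp
    moreover have "l \<notin> col n l ` (B - A)"
    proof
      assume "l \<in> col n l ` (B - A)"
      then obtain j where "j \<in> B" "l = col n l j" by blast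
      moreover have "j \<in> {1..n + 1}" using calculation(1) subs by blast
      ultimately show False using l by (auto simp: col_def split: if_splits)
    qed
    moreover have "l + n + 1 \<notin> col n l ` (B - A)" if lA: "l \<in> A"
    proof
      assume "l + n + 1 \<in> col n l ` (B - A)"
      then obtain j where "j \<in> B - A" "l + n + 1 = col n l j" by blast
      moreover have "j \<in> {1..n + 1}" using calculation(1) subs by blast
      ultimately show False using lA l by (auto simp: col_def split: if_splits)
    qed
    ultimately show ?thesis using False card_col fin by (auto simp: row)
  qed
qed

text \<open>The column condition follows by counting: the rows together have
  \<open>2 * (n + 1)\<close> marks, and by \<open>Union_row_cols\<close> at \<open>n + 1\<close>
  they cover all \<open>2 * (n + 1)\<close> columns, so no column is marked twice.\<close>

lemma Sigma_row_cols_dellac: "(SIGMA l:{1..n + 1}. row_cols n I l) \<in> dellac (n + 1)"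
proof -
  let ?C = "SIGMA l:{1..n + 1}. row_cols n I l"
  have union: "(\<Union>k\<in>{1..n + 1}. row_cols n I k) = {1..2 * (n + 1)}"
  proof -
    have "col n (n + 1) ` {1..n + 1} = (\<lambda>j. j + (n + 1)) ` {1..n + 1}"
      by (rule image_cong) (auto simp: col_def)
    also have "\<dots> = {n + 2..2 * (n + 1)}" unfolding image_add_atLeastAtMost' by simp
    finally show ?thesis
      unfolding Union_row_cols[OF order_refl] by (auto simp: extend_ends_def)
  qed
  have fin_row: "finite (row_cols n I l)" if "l \<in> {1..n + 1}" for l
    using card_row_cols[OF that] by (metis card.infinite zero_neq_numeral)
  then have fin: "finite ?C" by blast
  have card: "card ?C = 2 * (n + 1)"
    using fin_row card_row_cols by (subst card_SigmaI) auto
  have img: "snd ` ?C = {1..2 * (n + 1)}" unfolding union[symmetric] by force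
  have inj: "inj_on snd ?C"
    by (rule eq_card_imp_inj_on[OF fin]) (unfold img card, simp)
  have col_card: "card {i. (i, j) \<in> ?C} = 1" if "j \<in> {1..2 * (n + 1)}" for j
  proof -
    have "j \<in> snd ` ?C" using that by (simp only: img)
    then obtain i where i: "(i, j) \<in> ?C" by auto
    have "{i. (i, j) \<in> ?C} = {i}"
      using inj_onD[OF inj, of "(i, j)"] i by auto
    then show ?thesis by simp
  qed
  have bounds: "i \<le> j \<and> j \<le> n + 1 + i" if ij: "(i, j) \<in> ?C" for i j
  proof -
    have i: "i \<in> {1..n + 1}" using ij by blast
    have "extend_ends n I i \<subseteq> {1..n + 1}" using extend_ends_subset[of i] i by auto
    then show ?thesis using ij by (fastforce simp: row_cols_def Let_def col_def split: if_splits)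
  qed
  have "?C \<subseteq> {1..n + 1} \<times> {1..2 * (n + 1)}"
    unfolding union[symmetric] by blast
  moreover have "card {j. (i, j) \<in> ?C} = 2" if "i \<in> {1..n + 1}" for i
    using card_row_cols[OF that] that by simp
  ultimately show ?thesis
    using card col_card bounds unfolding dellac_def by blast
qed

lemma image_b_map_Sigma_row_cols:
  assumes l: "l \<le> n + 1"
  shows "b_map n (SIGMA l:{1..n + 1}. row_cols n I l) ` {1..2 * l} =
    {1..l} \<union> col n l ` extend_ends n I l"
proof -
  let ?\<sigma> = "b_map n (SIGMA l:{1..n + 1}. row_cols n I l)"
  have "{1..2 * l} = (\<Union>k\<in>{1..l}. {2 * k - 1, 2 * k})"
  proof (intro equalityI subsetI)
    fix i assume "i \<in> {1..2 * l}"
    then show "i \<in> (\<Union>k\<in>{1..l}. {2 * k - 1, 2 * k})"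
      by (intro UN_I[of "(i + 1) div 2"]) auto
  qed auto
  then have "?\<sigma> ` {1..2 * l} = (\<Union>k\<in>{1..l}. {?\<sigma> (2 * k - 1), ?\<sigma> (2 * k)})"
    by (simp add: image_UN)
  also have "\<dots> = (\<Union>k\<in>{1..l}. row_cols n I k)"
  proof (rule SUP_cong[OF refl])
    fix k assume "k \<in> {1..l}"
    then have k: "k \<in> {1..n + 1}" using l by auto
    show "{?\<sigma> (2 * k - 1), ?\<sigma> (2 * k)} = row_cols n I k"
      unfolding b_map_row(2)[OF Sigma_row_cols_dellac k] using k by simp
  qed
  also have "\<dots> = {1..l} \<union> col n l ` extend_ends n I l" by (rule Union_row_cols[OF l])
  finally show ?thesis .
qed

text \<open>The shift by one in \<open>bar\<close> is matched by \<open>kappa\<close>, which lowers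
  every index by one except 1. The ranges of \<open>s\<close> are those on which
  \<open>p_map\<close> has a uniform formula, with \<open>s = n + 1\<close> split off for the
  exceptional index.\<close>

lemma in_beta_sets_iff:
  assumes l: "l \<in> {1..n}"
  shows "s \<in> beta_sets n I l \<longleftrightarrow> 1 \<le> s \<and> s + 1 \<in> {1..l} \<union> col n l ` I l"
proof -
  have S: "I l \<subseteq> {1..n + 1}" using I l by (auto simp: fixed_point_indices_def)
  have "l \<le> n + 1" using l by simp
  note col_iff = in_col_image_iff[OF S this, of "s + 1"]
  note kappa_iff = in_kappa_image_iff[OF S, of "p_map n l s"]
  consider "s = 0" | "1 \<le> s" "s < l" | "l \<le> s" "s \<le> n" | "s = n + 1" | "n + 2 \<le> s" "s \<le> n + l" | "n + l < s"
    using l by force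
  then show ?thesis
  proof cases
    case 1
    then show ?thesis by (simp add: beta_sets_def)
  next
    case 2
    then show ?thesis using l by (simp add: beta_sets_def p_map_def)
  next
    case 3
    then have "p_map n l s = s" by (simp add: p_map_def)
    then show ?thesis using 3 l col_iff kappa_iff by (auto simp: beta_sets_def)
  next
    \<comment> \<open>\<open>kappa\<close> sends 1 to \<open>n + 1\<close>, and since
      \<open>1 \<le> l\<close> the column of 1 under \<open>col n l\<close> is \<open>n + 2\<close>,
      that is \<open>s + 1\<close>.\<close>
    case 4
    then have "p_map n l s = n + 1" using l by (simp add: p_map_def)
    then show ?thesis using 4 l col_iff kappa_iff S by (auto simp: beta_sets_def)
  next
    case 5
    then have "p_map n l s = s - n - 1" using l by (simp add: p_map_def)
    moreover have "s - n - 1 + 1 = s + 1 - (n + 1)" "1 \<le> s - n - 1" "s - n - 1 \<le> n" "s - n - 1 \<noteq> n + 1" "s - n \<le> l"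
      using 5 l by auto
    ultimately show ?thesis using 5 l col_iff kappa_iff by (simp add: beta_sets_def)
  next
    case 6
    then show ?thesis using l col_iff by (auto simp: beta_sets_def)
  qed
qed

text \<open>\<open>bar\<close> discards position 1, which carries the value 1. The odd prefix on the
  right thus comes from the first \<open>l\<close> full rows, and the discarded value explains the
  condition \<open>1 \<le> s\<close> in \<open>in_beta_sets_iff\<close>.\<close>

lemma beta_sets_eq:
  assumes l: "l \<in> {1..n}"
  shows "beta_sets n I l = bar n (b_map n (SIGMA l:{1..n + 1}. row_cols n I l)) ` {1..2 * l - 1}"
proof -
  let ?\<sigma> = "b_map n (SIGMA l:{1..n + 1}. row_cols n I l)"
  have "dellac_perm (n + 1) ?\<sigma>" by (rule dellac_perm_b_map[OF Sigma_row_cols_dellac])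
  then have "bruhat_le (2 * (n + 1)) ?\<sigma> (tau_perm (n + 1))" by (rule dellac_perm_le_tau)
  then have perm: "?\<sigma> permutes {1..2 * (n + 1)}" and one: "?\<sigma> 1 = 1"
    using bruhat_le_tau_perm by blast+
  have inj: "?\<sigma> x = ?\<sigma> y \<longleftrightarrow> x = y" for x y using permutes_inj[OF perm] by (simp add: inj_eq)
  \<comment> \<open>Only for positive values can the truncated subtraction in \<open>bar\<close> be
    undone.\<close>
  have pos: "1 \<le> ?\<sigma> (i + 1)" for i
  proof -
    have "?\<sigma> (i + 1) \<noteq> 0"
    proof
      assume "?\<sigma> (i + 1) = 0"
      also have "0 = ?\<sigma> 0" using permutes_not_in[OF perm, of 0] by simp
      finally have "i + 1 = 0" by (simp only: inj)
      then show False by simp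
    qed
    then show ?thesis by simp
  qed
  have bar_iff: "s \<in> bar n ?\<sigma> ` {1..2 * l - 1} \<longleftrightarrow> 1 \<le> s \<and> s + 1 \<in> ?\<sigma> ` {1..2 * l}" for s
  proof
    assume "s \<in> bar n ?\<sigma> ` {1..2 * l - 1}"
    then obtain i where i: "i \<in> {1..2 * l - 1}" and "s = bar n ?\<sigma> i" by blast
    then have s: "?\<sigma> (i + 1) = s + 1" using pos[of i] l by (auto simp: bar_def)
    have "?\<sigma> (i + 1) \<noteq> ?\<sigma> 1" using i by (simp only: inj) simp
    then have "1 \<le> s" unfolding s one by simp
    moreover have "i + 1 \<in> {1..2 * l}" using i by auto
    ultimately show "1 \<le> s \<and> s + 1 \<in> ?\<sigma> ` {1..2 * l}" using s by (metis image_eqI)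
  next
    assume s: "1 \<le> s \<and> s + 1 \<in> ?\<sigma> ` {1..2 * l}"
    then obtain i where i: "i \<in> {1..2 * l}" "s + 1 = ?\<sigma> i" by blast
    have "i \<noteq> 1" using i(2) s one by auto
    then have "i - 1 \<in> {1..2 * l - 1}" "i - 1 + 1 = i" using i(1) by auto
    moreover have "s = bar n ?\<sigma> (i - 1)"
      using calculation i(2) l by (auto simp: bar_def)
    ultimately show "s \<in> bar n ?\<sigma> ` {1..2 * l - 1}" by blast
  qed
  have image: "?\<sigma> ` {1..2 * l} = {1..l} \<union> col n l ` I l"
    using image_b_map_Sigma_row_cols[of l] l by (simp add: extend_ends_def)
  show ?thesis by (rule Set.set_eqI) (simp only: in_beta_sets_iff[OF l] bar_iff image)
qed

end

theorem theorem4: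
  fixes n :: nat
  assumes "n \<ge> 1"
  shows "f_map n \<in> torus_fixed (n + 1) n (degenerate_flags n) \<rightarrow> dellac (n + 1)
    \<and> b_map n \<in> dellac (n + 1) \<rightarrow> min_reps_le_tau (n + 1)
    \<and> alpha n \<in> min_reps_le_tau (n + 1) \<rightarrow> torus_fixed (2 * n) n (schubert_variety n (sigma_perm n))
    \<and> beta n \<in> torus_fixed (n + 1) n (degenerate_flags n)
               \<rightarrow> torus_fixed (2 * n) n (schubert_variety n (sigma_perm n))
    \<and> (\<forall>V \<in> torus_fixed (n + 1) n (degenerate_flags n). beta n V = alpha n (b_map n (f_map n V)))"
proof -
  let ?X = "torus_fixed (n + 1) n (degenerate_flags n)"
    and ?S = "torus_fixed (2 * n) n (schubert_variety n (sigma_perm n))"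
  have f: "f_map n V \<in> dellac (n + 1)" if "V \<in> ?X" for V
    unfolding f_map_def by (rule Sigma_row_cols_dellac[OF fixed_point_indices_index_sets[OF that]])
  have b: "b_map n C \<in> min_reps_le_tau (n + 1)" if "C \<in> dellac (n + 1)" for C
    by (rule dellac_perm_min_reps_le_tau[OF dellac_perm_b_map[OF that]])
  have a: "alpha n \<sigma> \<in> ?S" if "\<sigma> \<in> min_reps_le_tau (n + 1)" for \<sigma>
    using that by (intro alpha_fixed_point) (simp add: min_reps_le_tau_def)
  have comm: "beta n V = alpha n (b_map n (f_map n V))" if "V \<in> ?X" for V
    unfolding beta_def alpha_def perm_flag_def f_map_def coord_subspaces_def
    using beta_sets_eq[OF fixed_point_indices_index_sets[OF that]] by (intro restrict_ext) simp
  \<comment> \<open>That \<open>beta\<close> lands in the fixed points of the Schubert variety is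
    read off from \<open>comm\<close> and the other three maps.\<close>
  show ?thesis using f b a comm by auto
qed

end
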